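(* For all integers $g\ge 3$ and $k\ge 1$, there exists a collection $\mathcal{C}$ of circles in the plane, no two of which are concentric and no two of which are internally tangent, such that the tangency graph $G(\mathcal{C})$ has girth at least $g$ and chromatic number at least $k$.
   Context: The tangency graph $G(\mathcal{C})$ of a collection of circles $\mathcal{C}$ is the graph with vertex set $\mathcal{C}$ whose edges are the pairs of tangent circles in $\mathcal{C}$. The girth of a graph is the minimum length of a cycle in it. *)

theory Defs
  imports "HOL-Analysis.Analysis" "HOL-Library.Extended_Nat"
begin

text \<open>Circles are point sets of positive radius in the Euclidean plane.\<close>

definition is_circle :: "(real ^ 2) set \<Rightarrow> bool" where
  "is_circle A \<longleftrightarrow> (\<exists>c r. 0 < r \<and> A = sphere c r)"

definition concentric :: "(real ^ 2) set \<Rightarrow> (real ^ 2) set \<Rightarrow> bool" where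
  "concentric A B \<longleftrightarrow> (\<exists>c r s. 0 < r \<and> 0 < s \<and> A = sphere c r \<and> B = sphere c s)"

text \<open>As circles have positive radius, a circle is not tangent to itself.\<close>

definition tangent :: "(real ^ 2) set \<Rightarrow> (real ^ 2) set \<Rightarrow> bool" where
  "tangent A B \<longleftrightarrow> is_circle A \<and> is_circle B \<and> (\<exists>!p. p \<in> A \<inter> B)"

definition encloses :: "(real ^ 2) set \<Rightarrow> (real ^ 2) set \<Rightarrow> bool" where
  "encloses A B \<longleftrightarrow> (\<exists>c r. 0 < r \<and> A = sphere c r \<and> B \<subseteq> cball c r)"

definition internally_tangent :: "(real ^ 2) set \<Rightarrow> (real ^ 2) set \<Rightarrow> bool" where
  "internally_tangent A B \<longleftrightarrow> tangent A B \<and> (encloses A B \<or> encloses B A)"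

text \<open>A graph is a pair of a vertex set and a set of two-element edges.\<close>

type_synonym 'a graph = "'a set \<times> 'a set set"

definition tangency_graph :: "(real ^ 2) set set \<Rightarrow> (real ^ 2) set graph" where
  "tangency_graph \<C> = (\<C>, {{A, B} | A B. A \<in> \<C> \<and> B \<in> \<C> \<and> tangent A B})"

text \<open>A cycle is given by its list of vertices, in cyclic order and without repeating the first one.\<close>

definition is_cycle :: "'a graph \<Rightarrow> 'a list \<Rightarrow> bool" where
  "is_cycle G p \<longleftrightarrow> 3 \<le> length p \<and> distinct p \<and> set p \<subseteq> fst G \<and>
     (\<forall>i < length p. {p ! i, p ! (Suc i mod length p)} \<in> snd G)"

text \<open>The infimum of the empty set is \<open>\<infinity>\<close>: acyclic graphs have infinite girth, and
  graphs without a proper colouring by finitely many colours have infinite chromatic number.\<close>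

definition girth :: "'a graph \<Rightarrow> enat" where
  "girth G = Inf {enat (length p) | p. is_cycle G p}"

definition proper_colouring :: "'a graph \<Rightarrow> nat \<Rightarrow> ('a \<Rightarrow> nat) \<Rightarrow> bool" where
  "proper_colouring G n f \<longleftrightarrow> f ` fst G \<subseteq> {..<n} \<and>
     (\<forall>u \<in> fst G. \<forall>v \<in> fst G. {u, v} \<in> snd G \<longrightarrow> f u \<noteq> f v)"

definition chromatic_number :: "'a graph \<Rightarrow> enat" where
  "chromatic_number G = Inf {enat n | n. \<exists>f. proper_colouring G n f}"

end

theory Submission
  imports Defs
begin

text \<open>Tutte's construction raises the chromatic number: given a collection with circles indexed by \<open>X\<close>,
  take a set \<open>S\<close> of new circles and an \<open>X\<close>-uniform hypergraph on \<open>S\<close> that is not colourable with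
  \<open>k + 1\<close> colours and has no short cycles. For each hyperedge add a copy of the collection whose circles
  are matched with the circles of the hyperedge. Some hyperedge is monochromatic, so its copy
  misses a colour.

  To realise this, fix a unit vector \<open>u\<close> and let \<open>pt i\<close> be the point of the \<open>i\<close>-th circle in direction
  \<open>u\<close>. Words \<open>w\<close> over \<open>X\<close> are sent to the points \<open>\<Sum>\<^sub>j x\<^sub>j * pt (w ! j)\<close> with complex weights \<open>x\<^sub>j\<close>, so
  combinatorial lines become similar copies of the points \<open>pt i\<close>, and each of them carries a similar copy
  of the collection. Shifting that copy by \<open>\<rho>\<close> makes room for circles of radius \<open>\<rho>\<close> around the points. As the
  weights are complex, copies sharing a point are rotated against each other. For generic weights and
  small \<open>\<rho>\<close> there are no tangencies but the intended ones.

  The hypergraph comes from a Hales--Jewett theorem for families of lines without short cycles, proved by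
  partite amalgamation, with induction on the cycle length.\<close>

section \<open>Hypergraphs without short cycles\<close>

text \<open>Sparsity says that there is no Berge cycle of at most \<open>g\<close> hyperedges: every nonempty family of at
  most \<open>g\<close> hyperedges has a leaf. It also bounds the girth of graphs, whose edges are two-element sets.\<close>

definition edge_sparse :: "nat \<Rightarrow> ('i \<Rightarrow> 'v set) \<Rightarrow> 'i set \<Rightarrow> bool" where
  "edge_sparse g e L \<longleftrightarrow> (\<forall>F \<subseteq> L. finite F \<longrightarrow> F \<noteq> {} \<longrightarrow> card F \<le> g \<longrightarrow>
     (\<exists>f \<in> F. \<exists>p. e f \<inter> \<Union> (e ` (F - {f})) \<subseteq> {p}))"

lemma sparseD:
  assumes "edge_sparse g e L" "F \<subseteq> L" "finite F" "F \<noteq> {}" "card F \<le> g"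
  obtains f p where "f \<in> F" "e f \<inter> \<Union> (e ` (F - {f})) \<subseteq> {p}"
  using assms unfolding edge_sparse_def by meson

lemma sparse_subset: "edge_sparse g e L \<Longrightarrow> L' \<subseteq> L \<Longrightarrow> edge_sparse g e L'"
  unfolding edge_sparse_def by (meson subset_trans)

lemma sparse_one: "edge_sparse (Suc 0) e L"
  unfolding edge_sparse_def
proof (intro allI impI)
  fix F assume "F \<subseteq> L" "finite F" "F \<noteq> {}" "card F \<le> Suc 0"
  then have "card F = 1" by (metis One_nat_def card_0_eq le_Suc_eq le_zero_eq)
  then obtain f where "F = {f}" using card_1_singletonE by blast
  then show "\<exists>f\<in>F. \<exists>p. e f \<inter> \<Union> (e ` (F - {f})) \<subseteq> {p}" by auto
qed

text \<open>Each member of a family is lifted to one chosen index, which keeps the size of the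
  family even when \<open>h\<close> identifies indices.\<close>

lemma sparse_reindex:
  assumes "edge_sparse g (\<lambda>i. e (h i)) I"
  shows "edge_sparse g e (h ` I)"
  unfolding edge_sparse_def
proof (intro allI impI)
  fix F assume F: "F \<subseteq> h ` I" "finite F" "F \<noteq> {}" "card F \<le> g"
  obtain U where U: "U \<subseteq> I" "inj_on h U" "F = h ` U"
    using F(1) by (metis subset_image_inj)
  have "finite U" "card U \<le> g" "U \<noteq> {}"
    using F U by (auto simp: card_image finite_image_iff)
  then obtain u p where u: "u \<in> U" "e (h u) \<inter> \<Union> ((\<lambda>i. e (h i)) ` (U - {u})) \<subseteq> {p}"
    using sparseD[OF assms U(1)] by metis
  have "e ` (F - {h u}) = (\<lambda>i. e (h i)) ` (U - {u})"
    using U(2,3) u(1) by (auto simp: inj_on_def)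
  then have "e (h u) \<inter> \<Union> (e ` (F - {h u})) \<subseteq> {p}" using u(2) by (simp only:)
  then show "\<exists>f\<in>F. \<exists>p. e f \<inter> \<Union> (e ` (F - {f})) \<subseteq> {p}"
    using u(1) U(3) by blast
qed

lemma sparse_image:
  assumes "edge_sparse g e L" and inj: "inj_on h (\<Union> (e ` L))"
  shows "edge_sparse g (\<lambda>i. h ` e i) L"
  unfolding edge_sparse_def
proof (intro allI impI)
  fix F assume F: "F \<subseteq> L" "finite F" "F \<noteq> {}" "card F \<le> g"
  obtain f p where f: "f \<in> F" "e f \<inter> \<Union> (e ` (F - {f})) \<subseteq> {p}"
    using sparseD[OF assms(1) F] .
  have "h ` e f \<inter> \<Union> ((\<lambda>i. h ` e i) ` (F - {f})) \<subseteq> {h p}"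
  proof
    fix z assume "z \<in> h ` e f \<inter> \<Union> ((\<lambda>i. h ` e i) ` (F - {f}))"
    then obtain x y i where xy: "x \<in> e f" "z = h x" "i \<in> F - {f}" "y \<in> e i" "z = h y" by blast
    then have "x = y" using inj F(1) f(1) unfolding inj_on_def by blast
    then show "z \<in> {h p}" using f(2) xy by blast
  qed
  then show "\<exists>f\<in>F. \<exists>p. h ` e f \<inter> \<Union> ((\<lambda>i. h ` e i) ` (F - {f})) \<subseteq> {p}" using f(1) by blast
qed

text \<open>If the leaf given by sparsity already uses its free vertex at \<open>p\<close>, delete it and
  look for a leaf relative to its attaching vertex instead.\<close>

lemma sparse_pointed:
  assumes "edge_sparse g e L" "F \<subseteq> L" "finite F" "F \<noteq> {}" "card F \<le> g"
  shows "\<exists>f \<in> F. \<exists>q. e f \<inter> (\<Union> (e ` (F - {f})) \<union> {p}) \<subseteq> {q}"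
  using assms(2-)
proof (induction "card F" arbitrary: F p rule: less_induct)
  case less
  obtain f q where f: "f \<in> F" "e f \<inter> \<Union> (e ` (F - {f})) \<subseteq> {q}"
    using sparseD[OF assms(1) less.prems] .
  show ?case
  proof (cases "p \<in> e f \<and> p \<noteq> q \<and> q \<in> e f \<inter> \<Union> (e ` (F - {f}))")
    case False
    then have "\<exists>q. e f \<inter> (\<Union> (e ` (F - {f})) \<union> {p}) \<subseteq> {q}" using f(2) by blast
    then show ?thesis using f(1) by blast
  next
    case True
    have lt: "card (F - {f}) < card F" using f(1) less.prems(2) by (meson card_Diff1_less)
    have "F - {f} \<noteq> {}" using True by auto
    then obtain f' q' where f': "f' \<in> F - {f}"
        "e f' \<inter> (\<Union> (e ` (F - {f} - {f'})) \<union> {q}) \<subseteq> {q'}"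
      using less.hyps[OF lt, of q] less.prems lt by fastforce
    have "e f' \<inter> (\<Union> (e ` (F - {f'})) \<union> {p}) \<subseteq> {q'}"
    proof
      fix x assume x: "x \<in> e f' \<inter> (\<Union> (e ` (F - {f'})) \<union> {p})"
      \<comment> \<open>The hyperedge \<open>f\<close> meets the others at most in \<open>q\<close>,
        and \<open>p\<close> is another vertex of \<open>f\<close>, so \<open>p\<close> lies outside
        \<open>f'\<close>. Adding \<open>f\<close> back can only contribute \<open>q\<close>, which
        the choice of \<open>f'\<close> has allowed for.\<close>
      have ff: "e f \<inter> e f' \<subseteq> {q}" using f(2) f'(1) by blast
      then have "p \<notin> e f'" using True by blast
      then obtain i where i: "i \<in> F - {f'}" "x \<in> e i" using x by blast
      show "x \<in> {q'}"
      proof (cases "i = f")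
        case True then show ?thesis using ff i x f'(2) by blast
      next
        case False then show ?thesis using i x f'(2) by blast
      qed
    qed
    then show ?thesis using f'(1) by blast
  qed
qed

text \<open>Every piece of a short cycle through several copies enters and leaves its copy through \<open>T\<close>, so
  it has at least two edges there; this is why sparsity improves from \<open>g\<close> to \<open>Suc g\<close>.\<close>

lemma sparse_amalgam:
  fixes cp :: "'e \<Rightarrow> 'w \<Rightarrow> 'z"
  assumes g: "1 \<le> g"
    and E: "edge_sparse g (\<lambda>e. cp e ` T) E"
    and L: "edge_sparse (Suc g) D L"
    and DT: "\<And>m. m \<in> L \<Longrightarrow> \<exists>q. D m \<inter> T \<subseteq> {q}"
    and inj: "\<And>e. e \<in> E \<Longrightarrow> inj_on (cp e) (\<Union> (D ` L))"
    and meet: "\<And>e e' y y'. \<lbrakk>e \<in> E; e' \<in> E; e \<noteq> e'; y \<in> \<Union> (D ` L); y' \<in> \<Union> (D ` L); cp e y = cp e' y'\<rbrakk>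
      \<Longrightarrow> y \<in> T \<and> y' \<in> T"
  shows "edge_sparse (Suc g) (\<lambda>(e, m). cp e ` D m) (E \<times> L)"
  unfolding edge_sparse_def
proof (intro allI impI)
  fix F assume F: "F \<subseteq> E \<times> L" "finite F" "F \<noteq> {}" "card F \<le> Suc g"
  let ?ed = "\<lambda>(e, m). cp e ` D m"
  show "\<exists>f\<in>F. \<exists>p. ?ed f \<inter> \<Union> (?ed ` (F - {f})) \<subseteq> {p}"
  proof (cases "\<exists>e m. (e, m) \<in> F \<and> (\<forall>m'. (e, m') \<in> F \<longrightarrow> m' = m)")
    \<comment> \<open>A copy contributing a single hyperedge: other copies meet it only inside
      \<open>T\<close>, which \<open>D m\<close> meets at most once.\<close>
    case True
    then obtain e m where em: "(e, m) \<in> F" "\<And>m'. (e, m') \<in> F \<Longrightarrow> m' = m" by blast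
    have eE: "e \<in> E" "m \<in> L" using F(1) em(1) by auto
    obtain q where q: "D m \<inter> T \<subseteq> {q}" using DT[OF eE(2)] by blast
    have "cp e ` D m \<inter> \<Union> (?ed ` (F - {(e, m)})) \<subseteq> {cp e q}"
    proof
      fix z assume "z \<in> cp e ` D m \<inter> \<Union> (?ed ` (F - {(e, m)}))"
      then obtain y f where "y \<in> D m" "z = cp e y" "f \<in> F - {(e, m)}" "z \<in> ?ed f" by blast
      then obtain e' m' y' where *: "y \<in> D m" "z = cp e y" "(e', m') \<in> F" "(e', m') \<noteq> (e, m)"
          "y' \<in> D m'" "z = cp e' y'" by (cases f) auto
      have "e' \<noteq> e" using em(2) * by blast
      then have "y \<in> T" using meet[of e e' y y'] * eE F(1) by fastforce
      then show "z \<in> {cp e q}" using * q by blast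
    qed
    then show ?thesis using em(1) by (intro bexI[of _ "(e, m)"]) auto
  next
    case False
    \<comment> \<open>Every copy involved contributes at least two hyperedges, so there are at most
      half of \<open>Suc g\<close> copies, hence at most \<open>g\<close>, and \<open>E\<close>
      supplies a leaf among the copies.\<close>
    let ?fib = "\<lambda>e. {m. (e, m) \<in> F}"
    have fibfin: "finite (?fib e)" for e
      using finite_subset[of "?fib e" "snd ` F"] F(2) by force
    have F_eq: "F = Sigma (fst ` F) ?fib" by force
    have two: "2 \<le> card (?fib e)" if "e \<in> fst ` F" for e
    proof -
      obtain m where "(e, m) \<in> F" using \<open>e \<in> fst ` F\<close> by auto
      moreover obtain m' where "(e, m') \<in> F" "m' \<noteq> m" using False calculation by blast
      ultimately have "{m, m'} \<subseteq> ?fib e" "card {m, m'} = 2" by auto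
      then show ?thesis using card_mono[OF fibfin] by metis
    qed
    have "card F = (\<Sum>e\<in>fst ` F. card (?fib e))"
      by (subst F_eq, subst card_SigmaI) (use F(2) fibfin in auto)
    moreover have "(\<Sum>e\<in>fst ` F. 2) \<le> (\<Sum>e\<in>fst ` F. card (?fib e))"
      by (rule sum_mono) (rule two)
    ultimately have "2 * card (fst ` F) \<le> Suc g" using F(4) by simp
    then have "card (fst ` F) \<le> g" using g by linarith
    moreover have "fst ` F \<subseteq> E" using F(1) by auto
    ultimately obtain e p where e: "e \<in> fst ` F"
        "cp e ` T \<inter> \<Union> ((\<lambda>e. cp e ` T) ` (fst ` F - {e})) \<subseteq> {p}"
      using sparseD[OF E, of "fst ` F"] F by (metis finite_imageI image_is_empty)
    have eE: "e \<in> E" using e F(1) by auto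
    \<comment> \<open>The preimage in copy \<open>e\<close> of \<open>p\<close>, the only vertex
      where its image of \<open>T\<close> can meet the other copies; an arbitrary value if there is
      no preimage. The leaf inside the copy is sought relative to \<open>p0\<close>.\<close>
    define p0 where "p0 = (SOME y. y \<in> \<Union> (D ` L) \<and> cp e y = p)"
    have p0: "y = p0" if "y \<in> \<Union> (D ` L)" "cp e y = p" for y
      using someI[of "\<lambda>y. y \<in> \<Union> (D ` L) \<and> cp e y = p" y] that inj_onD[OF inj[OF eE]]
      unfolding p0_def by metis
    have cf: "card (?fib e) \<le> Suc g"
    proof -
      have "card (Pair e ` ?fib e) \<le> card F" by (rule card_mono) (use F(2) in auto)
      then show ?thesis using F(4) by (simp add: card_image inj_on_def)
    qed
    have "?fib e \<noteq> {}" "?fib e \<subseteq> L" using e F(1) by auto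
    then obtain m q where m: "m \<in> ?fib e" "D m \<inter> (\<Union> (D ` (?fib e - {m})) \<union> {p0}) \<subseteq> {q}"
      using sparse_pointed[OF L _ fibfin _ cf] by metis
    have mL: "m \<in> L" using m F(1) by auto
    have "cp e ` D m \<inter> \<Union> (?ed ` (F - {(e, m)})) \<subseteq> {cp e q}"
    proof
      fix z assume "z \<in> cp e ` D m \<inter> \<Union> (?ed ` (F - {(e, m)}))"
      then obtain y f where "y \<in> D m" "z = cp e y" "f \<in> F - {(e, m)}" "z \<in> ?ed f" by blast
      then obtain e' m' y' where *: "y \<in> D m" "z = cp e y" "(e', m') \<in> F" "(e', m') \<noteq> (e, m)"
          "y' \<in> D m'" "z = cp e' y'" by (cases f) auto
      have L': "m' \<in> L" "e' \<in> E" using * F(1) by auto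
      show "z \<in> {cp e q}"
      proof (cases "e' = e")
        case True
        then have "y = y'" using inj_onD[OF inj[OF eE], of y y'] * L' mL by auto
        then show ?thesis using m(2) *(1-5) True by blast
      next
        case False
        then have T: "y \<in> T" "y' \<in> T" using meet[of e e' y y'] * L' mL eE by auto
        have "e' \<in> fst ` F - {e}" using False *(3) by force
        then have "z \<in> cp e ` T \<inter> \<Union> ((\<lambda>e. cp e ` T) ` (fst ` F - {e}))"
          using T *(2,6) by blast
        then have "cp e y = p" using subsetD[OF e(2)] *(2) by simp
        then have "y = p0" using p0 *(1) mL by blast
        then show ?thesis using m(2) *(1,2) by blast
      qed
    qed
    then show ?thesis using m(1) by (intro bexI[of _ "(e, m)"]) auto
  qed
qed

section \<open>The Hales--Jewett theorem\<close>

text \<open>A combinatorial line is given by a template: \<open>None\<close> marks the active coordinates.\<close>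

definition subst :: "'a option list \<Rightarrow> 'a \<Rightarrow> 'a list" where
  "subst m a = map (case_option a id) m"

definition templates :: "nat \<Rightarrow> 'a set \<Rightarrow> 'a option list set" where
  "templates n X = {m. length m = n \<and> None \<in> set m \<and> set m \<subseteq> insert None (Some ` X)}"

definition words :: "nat \<Rightarrow> 'a set \<Rightarrow> 'a list set" where
  "words n X = {w. length w = n \<and> set w \<subseteq> X}"

lemma finite_words: "finite X \<Longrightarrow> finite (words n X)"
  unfolding words_def using finite_lists_length_eq[of X n] by (simp add: conj_commute)

lemma finite_templates: "finite X \<Longrightarrow> finite (templates n X)"
  by (rule finite_subset[OF _ finite_words[of "insert None (Some ` X)" n]])
     (auto simp: templates_def words_def)

lemma length_subst [simp]: "length (subst m a) = length m"
  by (simp add: subst_def)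

lemma subst_append [simp]: "subst (m @ m') a = subst m a @ subst m' a"
  by (simp add: subst_def)

lemma subst_const [simp]: "subst (map Some w) a = w"
  by (simp add: subst_def comp_def)

lemma nth_subst: "j < length m \<Longrightarrow> subst m a ! j = (case m ! j of None \<Rightarrow> a | Some b \<Rightarrow> b)"
  by (simp add: subst_def split: option.splits)

lemma subst_words: "m \<in> templates n X \<Longrightarrow> a \<in> X \<Longrightarrow> subst m a \<in> words n X"
  by (auto simp: templates_def words_def subst_def split: option.splits)

lemma subst_inj: "m \<in> templates n X \<Longrightarrow> subst m a = subst m b \<Longrightarrow> a = b"
  by (force simp: templates_def subst_def)

lemma map_Some_append_templates:
  "w \<in> words n X \<Longrightarrow> m \<in> templates n' X \<Longrightarrow> map Some w @ m \<in> templates (n + n') X"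
  by (auto simp: templates_def words_def)

lemma append_map_Some_templates:
  "m \<in> templates n' X \<Longrightarrow> w \<in> words n X \<Longrightarrow> m @ map Some w \<in> templates (n' + n) X"
  by (auto simp: templates_def words_def)

lemma templates_mono: "X \<subseteq> Y \<Longrightarrow> templates n X \<subseteq> templates n Y"
  by (auto simp: templates_def)

definition mono_line :: "('a list \<Rightarrow> nat) \<Rightarrow> 'a set \<Rightarrow> 'a option list \<Rightarrow> bool" where
  "mono_line \<kappa> X m \<longleftrightarrow> (\<exists>c. \<forall>a \<in> X. \<kappa> (subst m a) = c)"

text \<open>Colour focusing: the lines share the point \<open>f\<close> at the letter
  \<open>b\<close>, and \<open>C\<close> records the pairwise different colours that they have over
  \<open>X\<close>.\<close>

definition focused :: "('a list \<Rightarrow> nat) \<Rightarrow> 'a set \<Rightarrow> 'a \<Rightarrow> nat \<Rightarrow> nat \<Rightarrow> bool" where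
  "focused \<kappa> X b n r \<longleftrightarrow> (\<exists>f \<in> words n (insert b X). \<exists>C. card C = r \<and> finite C \<and>
     (\<forall>c \<in> C. \<exists>m \<in> templates n (insert b X). subst m b = f \<and> (\<forall>a \<in> X. \<kappa> (subst m a) = c)))"

text \<open>Prefixes are coloured by the whole colour pattern of their extensions; the hypothesis
  for \<open>X\<close> gives a template \<open>\<tau>\<close> along which this pattern is constant
  over \<open>X\<close>. Among the suffixes there is a monochromatic line or \<open>r\<close>
  focused lines, and combining the latter with \<open>\<tau>\<close> gives one more.\<close>

lemma focusing_step:
  fixes X :: "'a set"
  assumes fin: "finite X" and ne: "X \<noteq> {}"
    and HJ: "\<And>k. \<exists>n. \<forall>\<kappa> :: 'a list \<Rightarrow> nat. (\<forall>w. \<kappa> w < k) \<longrightarrow> (\<exists>m \<in> templates n X. mono_line \<kappa> X m)"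
  shows "\<exists>n. \<forall>\<kappa> :: 'a list \<Rightarrow> nat. (\<forall>w. \<kappa> w < k) \<longrightarrow>
      (\<exists>m \<in> templates n (insert b X). mono_line \<kappa> (insert b X) m) \<or> focused \<kappa> X b n r"
proof (induction r)
  case 0
  have "focused \<kappa> X b 0 0" for \<kappa>
    unfolding focused_def by (intro bexI[of _ "[]"] exI[of _ "{}"]) (auto simp: words_def)
  then show ?case by blast
next
  case (Suc r)
  let ?Y = "insert b X"
  obtain n where n: "\<And>\<kappa> :: 'a list \<Rightarrow> nat. (\<forall>w. \<kappa> w < k) \<Longrightarrow>
      (\<exists>m \<in> templates n ?Y. mono_line \<kappa> ?Y m) \<or> focused \<kappa> X b n r"
    using Suc.IH by blast
  obtain ws where ws: "set ws = words n ?Y" using finite_list[OF finite_words] fin by blast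
  let ?K = "words (length ws) {..<k}"
  \<comment> \<open>The colour patterns on \<open>ws\<close> are numbered, so that they can serve as
    colours themselves.\<close>
  obtain enc where enc: "bij_betw enc ?K {..<card ?K}"
    using ex_bij_betw_finite_nat[OF finite_words[of "{..<k}" "length ws"]]
    by (auto simp: atLeast0LessThan)
  obtain n' where n': "\<forall>\<kappa> :: 'a list \<Rightarrow> nat. (\<forall>w. \<kappa> w < card ?K) \<longrightarrow> (\<exists>m \<in> templates n' X. mono_line \<kappa> X m)"
    using HJ[of "card ?K"] by (elim exE)
  obtain a0 where a0: "a0 \<in> X" using ne by blast
  show ?case
  proof (intro exI[of _ "n' + n"] allI impI)
    fix \<kappa> :: "'a list \<Rightarrow> nat" assume \<kappa>: "\<forall>w. \<kappa> w < k"
    have K: "map (\<lambda>v. \<kappa> (u @ v)) ws \<in> ?K" for u using \<kappa> by (auto simp: words_def)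
    have "enc (map (\<lambda>v. \<kappa> (u @ v)) ws) < card ?K" for u
      using bij_betwE[OF enc] K by blast
    then obtain \<tau> c where \<tau>: "\<tau> \<in> templates n' X"
        "\<And>a. a \<in> X \<Longrightarrow> enc (map (\<lambda>v. \<kappa> (subst \<tau> a @ v)) ws) = c"
      using n'[rule_format, of "\<lambda>u. enc (map (\<lambda>v. \<kappa> (u @ v)) ws)"] unfolding mono_line_def by auto
    have \<tau>Y: "\<tau> \<in> templates n' ?Y" using \<tau> templates_mono[of X ?Y] by blast
    have same: "\<kappa> (subst \<tau> a @ v) = \<kappa> (subst \<tau> a0 @ v)" if "a \<in> X" "v \<in> words n ?Y" for a v
    proof -
      have "map (\<lambda>v. \<kappa> (subst \<tau> a @ v)) ws = map (\<lambda>v. \<kappa> (subst \<tau> a0 @ v)) ws"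
        by (rule inj_onD[OF bij_betw_imp_inj_on[OF enc] _ K K])
          (simp add: \<tau>(2)[OF \<open>a \<in> X\<close>] \<tau>(2)[OF a0])
      then show ?thesis using that ws by (simp add: map_eq_conv)
    qed
    let ?\<kappa> = "\<lambda>v. \<kappa> (subst \<tau> a0 @ v)"
    have pre: "\<exists>m \<in> templates (n' + n) ?Y. mono_line \<kappa> ?Y m"
      if "m \<in> templates n ?Y" "mono_line ?\<kappa> ?Y m" for m
    proof -
      have "subst \<tau> a0 \<in> words n' ?Y" using subst_words[OF \<tau>Y] a0 by blast
      then have "map Some (subst \<tau> a0) @ m \<in> templates (n' + n) ?Y"
        using map_Some_append_templates that(1) by blast
      then show ?thesis using that(2) unfolding mono_line_def
        by (intro bexI[of _ "map Some (subst \<tau> a0) @ m"]) auto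
    qed
    have "(\<exists>m \<in> templates n ?Y. mono_line ?\<kappa> ?Y m) \<or> focused ?\<kappa> X b n r"
      using n[of ?\<kappa>] \<kappa> by blast
    then show "(\<exists>m\<in>templates (n' + n) ?Y. mono_line \<kappa> ?Y m) \<or> focused \<kappa> X b (n' + n) (Suc r)"
    proof
      assume "focused ?\<kappa> X b n r"
      then obtain f C where f: "f \<in> words n ?Y" and C: "card C = r" "finite C"
        and m: "\<And>c. c \<in> C \<Longrightarrow> \<exists>m \<in> templates n ?Y. subst m b = f \<and> (\<forall>a \<in> X. ?\<kappa> (subst m a) = c)"
        unfolding focused_def by blast
      show ?thesis
      proof (cases "?\<kappa> f \<in> C")
        \<comment> \<open>The focus has the colour of one of its lines, which completes that line to
          the letter \<open>b\<close>.\<close>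
        case True
        then obtain m' where m': "m' \<in> templates n ?Y" "subst m' b = f" "\<forall>a \<in> X. ?\<kappa> (subst m' a) = ?\<kappa> f"
          using m[OF True] by blast
        then have "mono_line ?\<kappa> ?Y m'" unfolding mono_line_def by auto
        then show ?thesis using pre[OF m'(1)] by blast
      next
        case False
        \<comment> \<open>Each old line moves together with \<open>\<tau>\<close>, and
          \<open>\<tau>\<close> followed by the constant \<open>f\<close> is the new line, of colour
          \<open>?\<kappa> f\<close>. All of them pass through
          \<open>subst \<tau> b @ f\<close>.\<close>
        have "focused \<kappa> X b (n' + n) (Suc r)"
          unfolding focused_def
        proof (intro bexI[of _ "subst \<tau> b @ f"] exI[of _ "insert (?\<kappa> f) C"] conjI ballI)
          show "subst \<tau> b @ f \<in> words (n' + n) ?Y"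
            using f subst_words[OF \<tau>Y, of b] by (auto simp: words_def)
          show "card (insert (?\<kappa> f) C) = Suc r" using C False by simp
          show "finite (insert (?\<kappa> f) C)" using C by simp
          fix c assume "c \<in> insert (?\<kappa> f) C"
          then show "\<exists>m \<in> templates (n' + n) ?Y. subst m b = subst \<tau> b @ f \<and> (\<forall>a \<in> X. \<kappa> (subst m a) = c)"
          proof
            assume "c = ?\<kappa> f"
            then show ?thesis using append_map_Some_templates[OF \<tau>Y f] same[OF _ f]
              by (intro bexI[of _ "\<tau> @ map Some f"]) auto
          next
            assume "c \<in> C"
            then obtain m' where m': "m' \<in> templates n ?Y" "subst m' b = f" "\<forall>a \<in> X. ?\<kappa> (subst m' a) = c"
              using m by blast
            then have "\<tau> @ m' \<in> templates (n' + n) ?Y" using \<tau>Y by (auto simp: templates_def)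
            moreover have "\<kappa> (subst \<tau> a @ subst m' a) = c" if "a \<in> X" for a
              using same[OF that subst_words[OF m'(1), of a]] m'(3) that by auto
            ultimately show ?thesis using m'(2) by (intro bexI[of _ "\<tau> @ m'"]) auto
          qed
        qed
        then show ?thesis by blast
      qed
    qed (use pre in blast)
  qed
qed

text \<open>Induction on the alphabet: \<open>Suc k\<close> focused lines would need
  \<open>Suc k\<close> colours, so focusing must end in a monochromatic line.\<close>

theorem Hales_Jewett:
  fixes X :: "'a set"
  assumes "finite X"
  shows "\<exists>n. \<forall>\<kappa> :: 'a list \<Rightarrow> nat. (\<forall>w. \<kappa> w < k) \<longrightarrow> (\<exists>m \<in> templates n X. mono_line \<kappa> X m)"
  using assms
proof (induction X arbitrary: k rule: finite_induct)
  case empty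
  have "[None] \<in> templates 1 {}" by (simp add: templates_def)
  then show ?case unfolding mono_line_def by blast
next
  case (insert b X)
  show ?case
  proof (cases "X = {}")
    case True
    have "[None] \<in> templates 1 {b}" by (simp add: templates_def)
    then show ?thesis using True unfolding mono_line_def by auto
  next
    case False
    obtain n where n: "\<And>\<kappa> :: 'a list \<Rightarrow> nat. (\<forall>w. \<kappa> w < k) \<Longrightarrow>
        (\<exists>m \<in> templates n (insert b X). mono_line \<kappa> (insert b X) m) \<or> focused \<kappa> X b n (Suc k)"
      using focusing_step[OF insert.hyps(1) False insert.IH, of k b "Suc k"] by blast
    show ?thesis
    proof (intro exI[of _ n] allI impI)
      fix \<kappa> :: "'a list \<Rightarrow> nat" assume \<kappa>: "\<forall>w. \<kappa> w < k"
      have "\<not> focused \<kappa> X b n (Suc k)"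
      proof
        assume "focused \<kappa> X b n (Suc k)"
        then obtain C where C: "card C = Suc k" "finite C" "\<forall>c\<in>C. \<exists>m. \<forall>a \<in> X. \<kappa> (subst m a) = c"
          unfolding focused_def by blast
        have "C \<subseteq> {..<k}" using C(3) \<kappa> False by fastforce
        then show False using C(1) card_mono[of "{..<k}" C] by simp
      qed
      then show "\<exists>m\<in>templates n (insert b X). mono_line \<kappa> (insert b X) m" using n \<kappa> by blast
    qed
  qed
qed

section \<open>Lines without short cycles\<close>

text \<open>The letters of \<open>e\<close> are codes of words under \<open>to_nat\<close>, so that
  a set of words can serve as an alphabet of natural numbers; decoding replaces each letter by a
  block.\<close>

definition substw :: "nat option list \<Rightarrow> nat list \<Rightarrow> nat list" where
  "substw e y = concat (map (case_option y from_nat) e)"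

definition comp_template :: "nat option list \<Rightarrow> nat option list \<Rightarrow> nat option list" where
  "comp_template e m = concat (map (case_option m (\<lambda>b. map Some (from_nat b :: nat list))) e)"

lemma subst_comp_template: "subst (comp_template e m) a = substw e (subst m a)"
  by (induction e) (auto simp: comp_template_def substw_def subst_def comp_def split: option.splits)

lemma substw_eq_concat: "substw e y = concat (map from_nat (subst e (to_nat y)))"
  unfolding substw_def subst_def by (rule arg_cong[of _ _ concat]) (auto split: option.splits)

lemma length_concat_same: "(\<And>x. x \<in> set xs \<Longrightarrow> length x = N) \<Longrightarrow> length (concat xs) = length xs * N"
  by (induction xs) auto

lemma templates_cases:
  assumes "e \<in> templates n (to_nat ` V)" "x \<in> set e"
  obtains "x = None" | v where "v \<in> V" "x = Some (to_nat v)"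
  using assms by (auto simp: templates_def)

lemma length_block:
  fixes y :: "nat list" and X :: "nat set"
  assumes "e \<in> templates n (to_nat ` V)" "V \<subseteq> words N X" "x \<in> set e" "length y = N"
  shows "length (case_option y from_nat x) = N"
  by (rule templates_cases[OF assms(1,3)]) (use assms(2,4) in \<open>auto simp: words_def\<close>)

lemma concat_blocks_eqD:
  assumes "concat xs = concat ys" "length xs = length ys"
    "\<forall>x \<in> set xs. length x = N" "\<forall>y \<in> set ys. length y = N"
  shows "xs = ys"
  by (rule concat_injective[OF assms(1,2)])
     (use assms(3,4) in \<open>auto, metis set_zip_leftD set_zip_rightD\<close>)

lemma comp_template_templates:
  assumes e: "e \<in> templates n (to_nat ` V)" and V: "V \<subseteq> words N X" and m: "m \<in> templates N X"
  shows "comp_template e m \<in> templates (n * N) X"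
proof -
  have blk: "length (case_option m (\<lambda>b. map Some (from_nat b)) x) = N" if "x \<in> set e" for x
    by (rule templates_cases[OF e that]) (use V m in \<open>auto simp: templates_def words_def\<close>)
  have len: "length (comp_template e m) = n * N"
    unfolding comp_template_def using e blk
    by (subst length_concat_same[of _ N]) (auto simp: templates_def)
  have "None \<in> set (comp_template e m)"
    using e m unfolding comp_template_def by (auto simp: templates_def intro!: bexI[of _ None])
  moreover have "set (comp_template e m) \<subseteq> insert None (Some ` X)"
  proof -
    have "set (case_option m (\<lambda>b. map Some (from_nat b)) x) \<subseteq> insert None (Some ` X)" if "x \<in> set e" for x
      by (rule templates_cases[OF e that]) (use V m in \<open>auto simp: templates_def words_def\<close>)
    then show ?thesis unfolding comp_template_def set_concat set_map image_image by (rule UN_least)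
  qed
  ultimately show ?thesis using len by (simp add: templates_def)
qed

lemma substw_words:
  assumes e: "e \<in> templates n (to_nat ` V)" and V: "V \<subseteq> words N X" and y: "y \<in> words N X"
  shows "substw e y \<in> words (n * N) X"
proof -
  have len: "length (substw e y) = n * N"
    unfolding substw_def using e y length_block[OF e V]
    by (subst length_concat_same[of _ N]) (auto simp: templates_def words_def)
  moreover have "set (substw e y) \<subseteq> X"
  proof -
    have "set (case_option y from_nat x) \<subseteq> X" if "x \<in> set e" for x
      by (rule templates_cases[OF e that]) (use V y in \<open>auto simp: words_def\<close>)
    then show ?thesis unfolding substw_def set_concat set_map image_image by (rule UN_least)
  qed
  ultimately show ?thesis by (simp add: words_def)
qed

text \<open>Fixed blocks decode to words in \<open>V\<close>. As \<open>y\<close> lies outside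
  \<open>V\<close>, its occurrences mark exactly the active blocks on both sides, and this recovers
  the template.\<close>

lemma substw_eqD:
  assumes e: "e \<in> templates n (to_nat ` V)" "e' \<in> templates n (to_nat ` V)" and V: "V \<subseteq> words N X"
    and y: "length y = N" "length y' = N" and eq: "substw e y = substw e' y'" and out: "y \<notin> V"
  shows "e = e' \<and> y = y'"
proof -
  let ?B = "\<lambda>e y. map (case_option y (from_nat :: nat \<Rightarrow> nat list)) e"
  have len: "length e = n" "length e' = n" using e by (auto simp: templates_def)
  have blk: "\<forall>v \<in> set (?B e y). length v = N" "\<forall>v \<in> set (?B e' y'). length v = N"
    using length_block[OF _ V] e y by auto
  have "?B e y = ?B e' y'"
    using eq unfolding substw_def
    by (rule concat_blocks_eqD[OF _ _ blk]) (use len in simp)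
  then have nth: "case_option y from_nat (e ! j) = case_option y' from_nat (e' ! j)" if "j < n" for j
    using that len by (metis nth_map)
  have Some_V: "from_nat b \<in> V \<and> b = to_nat (from_nat b :: nat list)"
    if "j < n" "e ! j = Some b \<or> e' ! j = Some b" for j b
  proof -
    have "\<exists>d \<in> {e, e'}. Some b \<in> set d" using that len by (metis insertCI nth_mem)
    then obtain v where "v \<in> V" "b = to_nat v" using e by (auto simp: templates_def)
    then show ?thesis by simp
  qed
  obtain j where j: "j < n" "e ! j = None"
    using e(1) len by (auto simp: templates_def in_set_conv_nth)
  have yy: "y = y'"
    using nth[OF j(1)] j Some_V[of j] out by (cases "e' ! j") auto
  have "e ! i = e' ! i" if "i < n" for i
    using nth[OF that] Some_V[OF that] out yy
    by (cases "e ! i"; cases "e' ! i") (auto, metis)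
  then show ?thesis using yy len by (simp add: list_eq_iff_nth_eq)
qed

text \<open>\<open>\<pi>\<close> projects the words onto the vertices of an auxiliary hypergraph, and its fibres are the parts.
  The system is Ramsey for the colourings that are constant on the parts over \<open>S\<close>; a partite
  construction shrinks \<open>S\<close> to the empty set.\<close>

definition partite_system ::
  "nat set \<Rightarrow> nat \<Rightarrow> nat \<Rightarrow> nat list set \<Rightarrow> nat \<Rightarrow> nat option list set \<Rightarrow> (nat list \<Rightarrow> nat list) \<Rightarrow> bool" where
  "partite_system X g k S n L \<pi> \<longleftrightarrow>
     L \<subseteq> templates n X \<and> (\<forall>m \<in> L. inj_on (\<lambda>a. \<pi> (subst m a)) X) \<and>
     edge_sparse g (\<lambda>m. subst m ` X) L \<and>
     (\<forall>\<kappa>. (\<forall>w. \<kappa> w < k) \<longrightarrow>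
        (\<forall>x \<in> S. \<forall>v \<in> words n X. \<forall>w \<in> words n X. \<pi> v = x \<longrightarrow> \<pi> w = x \<longrightarrow> \<kappa> v = \<kappa> w) \<longrightarrow>
        (\<exists>m \<in> L. mono_line \<kappa> X m))"

definition sparse_HJ :: "nat \<Rightarrow> nat set \<Rightarrow> nat \<Rightarrow> bool" where
  "sparse_HJ g X k \<longleftrightarrow> (\<exists>n. \<exists>L \<subseteq> templates n X. edge_sparse g (\<lambda>m. subst m ` X) L \<and>
     (\<forall>\<kappa>. (\<forall>w. \<kappa> w < k) \<longrightarrow> (\<exists>m \<in> L. mono_line \<kappa> X m)))"

text \<open>The part \<open>V\<close> over \<open>x\<close> becomes an alphabet. Each template of a
  sparse family \<open>E\<close> over it carries a copy of the system, and distinct copies meet only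
  in their copies of \<open>V\<close>. A monochromatic line of \<open>E\<close> makes the part over
  \<open>x\<close> monochromatic in its copy, so constancy over \<open>x\<close> no longer has to be
  assumed.\<close>

lemma partite_step:
  assumes IH: "\<And>X :: nat set. finite X \<Longrightarrow> sparse_HJ g X k" and g: "1 \<le> g" and X: "finite X"
    and P: "partite_system X (Suc g) k (insert x S) N L \<pi>"
  shows "\<exists>N L \<pi>. partite_system X (Suc g) k S N L \<pi>"
proof -
  define V where "V = {w \<in> words N X. \<pi> w = x}"
  have V: "V \<subseteq> words N X" "finite V" using finite_words[OF X] by (auto simp: V_def)
  have L: "L \<subseteq> templates N X" "\<And>m. m \<in> L \<Longrightarrow> inj_on (\<lambda>a. \<pi> (subst m a)) X"
    "edge_sparse (Suc g) (\<lambda>m. subst m ` X) L"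
    using P by (auto simp: partite_system_def)
  have mono: "\<exists>m \<in> L. mono_line \<kappa> X m" if "\<forall>w. \<kappa> w < k"
    "\<forall>y \<in> insert x S. \<forall>v \<in> words N X. \<forall>w \<in> words N X. \<pi> v = y \<longrightarrow> \<pi> w = y \<longrightarrow> \<kappa> v = \<kappa> w" for \<kappa>
    using P that unfolding partite_system_def by blast
  have verts: "subst m a \<in> words N X" if "m \<in> L" "a \<in> X" for m a
    by (rule subst_words[OF subsetD[OF L(1) that(1)] that(2)])
  obtain n E where E: "E \<subseteq> templates n (to_nat ` V)"
      "edge_sparse g (\<lambda>e. subst e ` to_nat ` V) E"
      "\<And>\<kappa>. \<forall>w. \<kappa> w < k \<Longrightarrow> \<exists>e \<in> E. mono_line \<kappa> (to_nat ` V) e"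
    using IH[of "to_nat ` V"] V(2) unfolding sparse_HJ_def by auto
  have eqD: "(y \<in> V \<and> y' \<in> V) \<or> (e = e' \<and> y = y')"
    if "e \<in> E" "e' \<in> E" "y \<in> words N X" "y' \<in> words N X" "substw e y = substw e' y'" for e e' y y'
    using substw_eqD[of e n V e' N X y y'] substw_eqD[of e' n V e N X y' y] that E(1) V(1)
    by (auto simp: words_def)
  \<comment> \<open>The choice of preimage is harmless: two different preimages of a word both lie
    in \<open>V\<close>, where \<open>\<pi>\<close> has the value \<open>x\<close>.\<close>
  define \<pi>' where "\<pi>' w = \<pi> (SOME y. y \<in> words N X \<and> (\<exists>e \<in> E. w = substw e y))" for w
  have \<pi>': "\<pi>' (substw e y) = \<pi> y" if "e \<in> E" "y \<in> words N X" for e y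
  proof -
    let ?P = "\<lambda>z. z \<in> words N X \<and> (\<exists>e' \<in> E. substw e y = substw e' z)"
    have "?P (SOME z. ?P z)" by (rule someI[of ?P y]) (use that in blast)
    then obtain e' where "e' \<in> E" "(SOME z. ?P z) \<in> words N X" "substw e y = substw e' (SOME z. ?P z)"
      by blast
    then have "\<pi> (SOME z. ?P z) = \<pi> y" using eqD[of e e' y "SOME z. ?P z"] that by (auto simp: V_def)
    then show ?thesis by (simp add: \<pi>'_def)
  qed
  define L' where "L' = (\<lambda>(e, m). comp_template e m) ` (E \<times> L)"
  have "partite_system X (Suc g) k S (n * N) L' \<pi>'"
    unfolding partite_system_def
  proof (intro conjI ballI allI impI)
    show "L' \<subseteq> templates (n * N) X"
      using E(1) L(1) by (auto simp: L'_def intro!: comp_template_templates[OF _ V(1)])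
    fix l assume "l \<in> L'"
    then obtain e m where l: "l = comp_template e m" "e \<in> E" "m \<in> L" by (auto simp: L'_def)
    have "\<pi>' (subst l a) = \<pi> (subst m a)" if "a \<in> X" for a
      using \<pi>'[OF l(2) verts[OF l(3) that]] by (simp add: l subst_comp_template)
    then show "inj_on (\<lambda>a. \<pi>' (subst l a)) X" using L(2)[OF l(3)] by (simp add: inj_on_def)
  next
    have "edge_sparse (Suc g) (\<lambda>(e, m). substw e ` subst m ` X) (E \<times> L)"
    proof (rule sparse_amalgam[OF g, where T = V])
      show "edge_sparse g (\<lambda>e. substw e ` V) E"
      proof -
        have "inj_on (\<lambda>w. concat (map from_nat w) :: nat list) (\<Union>e\<in>E. subst e ` to_nat ` V)"
        proof (rule inj_onI)
          fix u w assume u: "u \<in> (\<Union>e\<in>E. subst e ` to_nat ` V)" and w: "w \<in> (\<Union>e\<in>E. subst e ` to_nat ` V)"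
            and eq: "concat (map from_nat u) = (concat (map from_nat w) :: nat list)"
          have *: "u \<in> words n (to_nat ` V)" "w \<in> words n (to_nat ` V)"
            using u w E(1) by (auto intro!: subst_words[OF subsetD[OF E(1)]])
          have "map from_nat u = (map from_nat w :: nat list list)"
          proof (rule concat_blocks_eqD[OF eq])
            have "length (from_nat b :: nat list) = N" if "b \<in> to_nat ` V" for b
              using that V(1) by (auto simp: words_def)
            then show "\<forall>y \<in> set (map from_nat u :: nat list list). length y = N"
              "\<forall>y \<in> set (map from_nat w :: nat list list). length y = N"
              using * unfolding words_def by (auto dest!: subsetD)
          qed (use * in \<open>simp add: words_def\<close>)
          then have "map (to_nat \<circ> (from_nat :: nat \<Rightarrow> nat list)) u = map (to_nat \<circ> (from_nat :: nat \<Rightarrow> nat list)) w"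
            by (metis map_map)
          moreover have "map (to_nat \<circ> (from_nat :: nat \<Rightarrow> nat list)) v = v" if "v \<in> words n (to_nat ` V)" for v
            using that by (auto simp: words_def intro!: map_idI)
          ultimately show "u = w" using * by simp
        qed
        from sparse_image[OF E(2) this] show ?thesis
          by (simp add: image_image substw_eq_concat)
      qed
      show "edge_sparse (Suc g) (\<lambda>m. subst m ` X) L" by (rule L)
      show "\<exists>q. subst m ` X \<inter> V \<subseteq> {q}" if "m \<in> L" for m
      proof (cases "subst m ` X \<inter> V = {}")
        case False
        then obtain a where a: "a \<in> X" "\<pi> (subst m a) = x" by (auto simp: V_def)
        have "subst m ` X \<inter> V \<subseteq> {subst m a}"
          using L(2)[OF that] a by (auto simp: V_def inj_on_def)
        then show ?thesis by blast
      qed auto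
      show "inj_on (substw e) (\<Union>m\<in>L. subst m ` X)" if "e \<in> E" for e
      proof (rule inj_onI)
        fix y y' assume y: "y \<in> (\<Union>m\<in>L. subst m ` X)" "y' \<in> (\<Union>m\<in>L. subst m ` X)"
          and eq: "substw e y = substw e y'"
        have e: "e \<in> templates n (to_nat ` V)" using that E(1) by blast
        have len: "length y = N" "length y' = N" using y verts by (auto simp: words_def)
        then have blk: "\<forall>v \<in> set (map (case_option y from_nat) e). length v = N"
          "\<forall>v \<in> set (map (case_option y' from_nat) e). length v = N"
          using length_block[OF e V(1)] by auto
        have "map (case_option y from_nat) e = map (case_option y' from_nat) e"
          using eq unfolding substw_def
          by (rule concat_blocks_eqD[OF _ _ blk]) simp
        then show "y = y'" using e by (force simp: templates_def)
      qed
      show "y \<in> V \<and> y' \<in> V" if "e \<in> E" "e' \<in> E" "e \<noteq> e'" "y \<in> (\<Union>m\<in>L. subst m ` X)"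
        "y' \<in> (\<Union>m\<in>L. subst m ` X)" "substw e y = substw e' y'" for e e' y y'
        using eqD[of e e' y y'] that verts by auto
    qed
    moreover have "(\<lambda>(e, m). substw e ` subst m ` X) = (\<lambda>i. subst ((\<lambda>(e, m). comp_template e m) i) ` X)"
      by (auto simp: subst_comp_template image_image fun_eq_iff)
    ultimately show "edge_sparse (Suc g) (\<lambda>m. subst m ` X) L'"
      unfolding L'_def by (intro sparse_reindex) simp
  next
    fix \<kappa> :: "nat list \<Rightarrow> nat" assume \<kappa>: "\<forall>w. \<kappa> w < k"
      and const: "\<forall>y\<in>S. \<forall>v\<in>words (n * N) X. \<forall>w\<in>words (n * N) X. \<pi>' v = y \<longrightarrow> \<pi>' w = y \<longrightarrow> \<kappa> v = \<kappa> w"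
    \<comment> \<open>The colouring pulled back along \<open>e\<close> is constant on
      \<open>V\<close>, so it also meets the condition over \<open>x\<close> that the given system
      asks for.\<close>
    obtain e c where e: "e \<in> E" "\<And>a. a \<in> to_nat ` V \<Longrightarrow> \<kappa> (concat (map from_nat (subst e a))) = c"
      using E(3)[of "\<lambda>w. \<kappa> (concat (map from_nat w))"] \<kappa> unfolding mono_line_def by auto
    have c: "\<kappa> (substw e y) = c" if "y \<in> V" for y
      using e(2)[of "to_nat y"] that by (simp add: substw_eq_concat)
    have "\<kappa> (substw e v) = \<kappa> (substw e w)"
      if "y \<in> insert x S" "v \<in> words N X" "w \<in> words N X" "\<pi> v = y" "\<pi> w = y" for v w y
    proof (cases "y = x")
      case True then show ?thesis using c[of v] c[of w] that by (auto simp: V_def)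
    next
      case False
      have "substw e v \<in> words (n * N) X" "substw e w \<in> words (n * N) X"
        using substw_words[OF _ V(1)] that e(1) E(1) by blast+
      moreover have "\<pi>' (substw e v) = y" "\<pi>' (substw e w) = y"
        using \<pi>'[OF e(1)] that by auto
      moreover have "y \<in> S" using False that by blast
      ultimately show ?thesis using const by blast
    qed
    then obtain m where m: "m \<in> L" "mono_line (\<lambda>y. \<kappa> (substw e y)) X m"
      using mono[of "\<lambda>y. \<kappa> (substw e y)"] \<kappa> by blast
    then have "mono_line \<kappa> X (comp_template e m)" by (simp add: mono_line_def subst_comp_template)
    moreover have "comp_template e m \<in> L'" using m e by (auto simp: L'_def)
    ultimately show "\<exists>m\<in>L'. mono_line \<kappa> X m" by blast
  qed
  then show ?thesis by blast
qed

text \<open>A constant suffix records the values of a template at \<open>a\<close> and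
  \<open>b\<close>, which determine it, so the extended lines are pairwise disjoint. Projecting the
  suffix away leaves the ordinary Hales-Jewett theorem.\<close>

lemma partite_start:
  assumes X: "finite X" and ab: "a \<in> X" "b \<in> X" "a \<noteq> b"
  shows "\<exists>n N L \<pi>. partite_system X g k (words n X) N L \<pi>"
proof -
  obtain n where n: "\<And>\<kappa> :: nat list \<Rightarrow> nat. \<forall>w. \<kappa> w < k \<Longrightarrow> \<exists>m \<in> templates n X. mono_line \<kappa> X m"
    using Hales_Jewett[OF X, of k] by blast
  define suf where "suf m = subst m a @ subst m b" for m
  have suf_words: "suf m \<in> words (n + n) X" if "m \<in> templates n X" for m
    using subst_words[OF that ab(1)] subst_words[OF that ab(2)] by (auto simp: suf_def words_def)
  have suf_inj: "m = m'" if "m \<in> templates n X" "m' \<in> templates n X" "suf m = suf m'" for m m'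
  proof -
    have len: "length m = n" "length m' = n" using that by (auto simp: templates_def)
    then have "subst m a = subst m' a" "subst m b = subst m' b" using that(3) by (auto simp: suf_def)
    then have eq: "subst m a ! j = subst m' a ! j" "subst m b ! j = subst m' b ! j" for j by simp_all
    have "m ! j = m' ! j" if "j < n" for j
      using eq[of j] that len ab(3)
      by (cases "m ! j"; cases "m' ! j") (auto simp: nth_subst)
    then show ?thesis using len by (simp add: list_eq_iff_nth_eq)
  qed
  define ext where "ext m = m @ map Some (suf m)" for m
  let ?L = "ext ` templates n X"
  have "partite_system X g k (words n X) (n + (n + n)) ?L (take n)"
    unfolding partite_system_def
  proof (intro conjI ballI allI impI)
    show "?L \<subseteq> templates (n + (n + n)) X"
      using append_map_Some_templates suf_words by (fastforce simp: ext_def)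
    fix l assume "l \<in> ?L"
    then obtain m where m: "m \<in> templates n X" "l = ext m" by blast
    then have "take n (subst l c) = subst m c" for c
      by (auto simp: ext_def templates_def)
    then show "inj_on (\<lambda>a. take n (subst l a)) X"
      using subst_inj[OF m(1)] by (auto simp: inj_on_def)
  next
    have "m = m'" if "m \<in> templates n X" "m' \<in> templates n X"
      "subst (ext m) c = subst (ext m') c'" for m m' c c'
      using that suf_inj[of m m'] by (auto simp: ext_def templates_def)
    then have disj: "subst l ` X \<inter> subst l' ` X = {}" if "l \<in> ?L" "l' \<in> ?L" "l \<noteq> l'" for l l'
      using that by blast
    show "edge_sparse g (\<lambda>m. subst m ` X) ?L"
      unfolding edge_sparse_def
    proof (intro allI impI)
      fix F assume F: "F \<subseteq> ?L" "F \<noteq> {}"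
      then obtain f where f: "f \<in> F" by blast
      have "subst f ` X \<inter> subst l ` X = {}" if "l \<in> F - {f}" for l
        using disj[of f l] that f F(1) by blast
      then have "subst f ` X \<inter> \<Union> ((\<lambda>m. subst m ` X) ` (F - {f})) = {}"
        by (simp only: Int_UN_distrib) simp
      then show "\<exists>f\<in>F. \<exists>p. subst f ` X \<inter> \<Union> ((\<lambda>m. subst m ` X) ` (F - {f})) \<subseteq> {p}"
        using f by blast
    qed
  next
    fix \<kappa> :: "nat list \<Rightarrow> nat" assume \<kappa>: "\<forall>w. \<kappa> w < k"
      and const: "\<forall>x\<in>words n X. \<forall>v\<in>words (n + (n + n)) X. \<forall>w\<in>words (n + (n + n)) X.
        take n v = x \<longrightarrow> take n w = x \<longrightarrow> \<kappa> v = \<kappa> w"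
    \<comment> \<open>Any fixed suffix over \<open>X\<close> would serve: the colour depends only on
      the prefix.\<close>
    let ?s = "replicate (n + n) a"
    obtain m c where m: "m \<in> templates n X" "\<And>d. d \<in> X \<Longrightarrow> \<kappa> (subst m d @ ?s) = c"
      using n[of "\<lambda>w. \<kappa> (w @ ?s)"] \<kappa> unfolding mono_line_def by blast
    have "\<kappa> (subst (ext m) d) = c" if "d \<in> X" for d
    proof -
      have w: "subst m d \<in> words n X" by (rule subst_words[OF m(1) that])
      then have "subst m d @ ?s \<in> words (n + (n + n)) X" "subst (ext m) d \<in> words (n + (n + n)) X"
          "take n (subst m d @ ?s) = subst m d" "take n (subst (ext m) d) = subst m d"
        using ab(1) suf_words[OF m(1)] by (auto simp: words_def ext_def)
      then have "\<kappa> (subst (ext m) d) = \<kappa> (subst m d @ ?s)" using const w by blast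
      then show ?thesis using m(2)[OF that] by simp
    qed
    then show "\<exists>m\<in>?L. mono_line \<kappa> X m" using m(1) unfolding mono_line_def by blast
  qed
  then show ?thesis by blast
qed

text \<open>Induction on \<open>g\<close> from the ordinary theorem. Disjoint lines start the
  partite construction, and each use of \<open>partite_step\<close> discharges one part; when none
  is left, the colouring is arbitrary.\<close>

theorem sparse_Hales_Jewett: "finite X \<Longrightarrow> sparse_HJ (Suc g) X k"
proof (induction g arbitrary: X)
  case 0
  then show ?case using Hales_Jewett[of X k] sparse_one unfolding sparse_HJ_def by blast
next
  case (Suc g)
  show ?case
  proof (cases "\<exists>a \<in> X. \<exists>b \<in> X. a \<noteq> b")
    \<comment> \<open>Over at most one letter every line is monochromatic, and one template
      suffices.\<close>
    case False
    have "edge_sparse (Suc (Suc g)) (\<lambda>m. subst m ` X) {[None]}"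
      unfolding edge_sparse_def by (auto simp: subset_singleton_iff)
    moreover have "mono_line \<kappa> X [None]" for \<kappa>
      using False unfolding mono_line_def by metis
    ultimately show ?thesis unfolding sparse_HJ_def
      by (intro exI[of _ 1] exI[of _ "{[None]}"]) (auto simp: templates_def)
  next
    case True
    then obtain a b where "a \<in> X" "b \<in> X" "a \<noteq> b" by blast
    then obtain n where n: "\<exists>N L \<pi>. partite_system X (Suc (Suc g)) k (words n X) N L \<pi>"
      using partite_start[OF Suc.prems, of a b "Suc (Suc g)" k] by blast
    have "\<exists>N L \<pi>. partite_system X (Suc (Suc g)) k {} N L \<pi>"
      if "finite S" "\<exists>N L \<pi>. partite_system X (Suc (Suc g)) k S N L \<pi>" for S
      using that
    proof (induction S rule: finite_induct)
      case (insert x S)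
      then show ?case using partite_step[OF Suc.IH _ Suc.prems, of x S] by auto
    qed
    from this[OF finite_words[OF Suc.prems] n]
    show ?thesis unfolding partite_system_def sparse_HJ_def by blast
  qed
qed

section \<open>Generic weights\<close>

text \<open>Polynomial dependence is recorded only along real lines. This is enough to find a common
  non-root of finitely many functions and avoids polynomials in many variables.\<close>

definition line_polynomial :: "((nat \<Rightarrow> complex) \<Rightarrow> real) \<Rightarrow> bool" where
  "line_polynomial f \<longleftrightarrow> (\<forall>x y. \<exists>P :: real poly. \<forall>s. f (\<lambda>j. x j + of_real s * y j) = poly P s)"

definition linear_form :: "nat \<Rightarrow> (nat \<Rightarrow> complex) \<Rightarrow> (nat \<Rightarrow> complex) \<Rightarrow> complex" where
  "linear_form n y x = (\<Sum>j<n. x j * y j)"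

lemma line_polynomial_const: "line_polynomial (\<lambda>x. a)"
  unfolding line_polynomial_def by (auto intro: exI[of _ "[:a:]"])

lemma line_polynomial_diff: "line_polynomial f \<Longrightarrow> line_polynomial h \<Longrightarrow> line_polynomial (\<lambda>x. f x - h x)"
  unfolding line_polynomial_def by (metis poly_diff)

lemma line_polynomial_mult: "line_polynomial f \<Longrightarrow> line_polynomial h \<Longrightarrow> line_polynomial (\<lambda>x. f x * h x)"
  unfolding line_polynomial_def by (metis poly_mult)

lemma line_polynomial_cmod: "line_polynomial (\<lambda>x. (cmod (linear_form n y x))\<^sup>2)"
  unfolding line_polynomial_def
proof (intro allI)
  fix a b :: "nat \<Rightarrow> complex"
  let ?A = "linear_form n y a" and ?B = "linear_form n y b"
  have "linear_form n y (\<lambda>j. a j + of_real s * b j) = ?A + of_real s * ?B" for s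
    by (simp add: linear_form_def sum.distrib sum_distrib_left algebra_simps)
  then have "(cmod (linear_form n y (\<lambda>j. a j + of_real s * b j)))\<^sup>2
      = poly ([:Re ?A, Re ?B:] ^ 2 + [:Im ?A, Im ?B:] ^ 2) s" for s
    by (simp add: cmod_power2)
  then show "\<exists>P. \<forall>s. (cmod (linear_form n y (\<lambda>j. a j + of_real s * b j)))\<^sup>2 = poly P s" by blast
qed

text \<open>On the line from a point \<open>x\<close> good for \<open>I\<close> to a point
  \<open>y\<close> good for the new index, every function restricts to a nonzero polynomial, by its
  value at one of the two ends, and finitely many such polynomials have finitely many roots.\<close>

lemma line_polynomial_generic:
  assumes "finite I" "\<And>i. i \<in> I \<Longrightarrow> line_polynomial (f i)" "\<And>i. i \<in> I \<Longrightarrow> \<exists>x. f i x \<noteq> 0"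
  shows "\<exists>x. \<forall>i \<in> I. f i x \<noteq> 0"
  using assms
proof (induction I rule: finite_induct)
  case (insert i I)
  obtain x where x: "\<forall>j \<in> I. f j x \<noteq> 0"
    using insert.IH[OF insert.prems] by auto
  obtain y where y: "f i y \<noteq> 0" using insert.prems(2)[of i] by auto
  let ?z = "\<lambda>s j. x j + of_real s * (y j - x j)"
  have "\<exists>P. \<forall>s. f j (?z s) = poly P s" if "j \<in> insert i I" for j
    using insert.prems(1)[OF that] unfolding line_polynomial_def by (elim allE)
  then obtain P where P: "\<And>j s. j \<in> insert i I \<Longrightarrow> f j (?z s) = poly (P j) s" by metis
  have "P j \<noteq> 0" if "j \<in> insert i I" for j
    using P[OF that, of 0] P[OF that, of 1] x y that by auto
  then have "finite (\<Union>j \<in> insert i I. {s. poly (P j) s = 0})"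
    using insert.hyps(1) poly_roots_finite by blast
  then obtain s where "s \<notin> (\<Union>j \<in> insert i I. {s. poly (P j) s = 0})"
    using ex_new_if_finite[OF infinite_UNIV_char_0] by blast
  then show ?case using P by (intro exI[of _ "?z s"]) auto
qed auto

lemma linear_form_single:
  "j < n \<Longrightarrow> linear_form n y (\<lambda>k. if k = j then \<alpha> else 0) = \<alpha> * y j"
  unfolding linear_form_def by (simp add: if_distrib[of "\<lambda>z. z * _"] cong: if_cong)

lemma linear_form_double:
  assumes "j < n" "l < n" "j \<noteq> l"
  shows "linear_form n y (\<lambda>k. if k = j then \<alpha> else if k = l then \<beta> else 0) = \<alpha> * y j + \<beta> * y l"
proof -
  have "linear_form n y (\<lambda>k. if k = j then \<alpha> else if k = l then \<beta> else 0)
     = linear_form n y (\<lambda>k. if k = j then \<alpha> else 0) + linear_form n y (\<lambda>k. if k = l then \<beta> else 0)"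
    unfolding linear_form_def sum.distrib[symmetric] using assms(3) by (intro sum.cong) auto
  then show ?thesis using assms by (simp add: linear_form_single)
qed

text \<open>With squared arguments, \<open>gap\<close> vanishes exactly when the two circles are tangent internally
  or externally. Unlike the tangency conditions it is polynomial in the squared radii.\<close>

definition gap :: "real \<Rightarrow> real \<Rightarrow> real \<Rightarrow> real" where
  "gap d r s = (d - r - s)\<^sup>2 - 4 * r * s"

lemma gap_eq_0: "d = r + s \<or> d = \<bar>r - s\<bar> \<Longrightarrow> gap (d\<^sup>2) (r\<^sup>2) (s\<^sup>2) = 0"
  unfolding gap_def by (auto simp: power2_eq_square algebra_simps)

lemma gap_commute: "gap d r s = gap d s r"
  by (simp add: gap_def algebra_simps)

section \<open>Choice of the direction \<open>u\<close>\<close>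

lemma finite_circle_intersection:
  fixes d :: complex
  assumes "d \<noteq> 0" "0 < \<rho>"
  shows "finite {u. cmod u = 1 \<and> cmod (d + of_real \<rho> * u) = \<sigma>}"
proof -
  \<comment> \<open>Multiplying by \<open>cnj d\<close> makes the equation linear: \<open>h\<close>
    is the forced real part of \<open>cnj d * u\<close>, whose modulus is that of \<open>d\<close>,
    so its imaginary part is \<open>q\<close> or \<open>- q\<close>.\<close>
  define h where "h = (\<sigma>\<^sup>2 - (cmod d)\<^sup>2 - \<rho>\<^sup>2) / (2 * \<rho>)"
  define q where "q = sqrt ((cmod d)\<^sup>2 - h\<^sup>2)"
  have "u \<in> {Complex h q / cnj d, Complex h (- q) / cnj d}"
    if u: "cmod u = 1" "cmod (d + of_real \<rho> * u) = \<sigma>" for u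
  proof -
    let ?z = "cnj d * u"
    have u1: "(Re u)\<^sup>2 + (Im u)\<^sup>2 = 1" using u(1) by (metis cmod_power2 one_power2)
    have "\<sigma>\<^sup>2 = (cmod d)\<^sup>2 + \<rho>\<^sup>2 * ((Re u)\<^sup>2 + (Im u)\<^sup>2) + 2 * \<rho> * Re ?z"
      unfolding u(2)[symmetric] cmod_power2 by (simp add: power2_eq_square algebra_simps)
    then have "\<sigma>\<^sup>2 = (cmod d)\<^sup>2 + \<rho>\<^sup>2 + 2 * \<rho> * Re ?z" unfolding u1 by simp
    then have re: "Re ?z = h" using assms(2) by (simp add: h_def field_simps)
    have "(cmod ?z)\<^sup>2 = (cmod d)\<^sup>2" using u(1) by (simp add: norm_mult)
    then have "h\<^sup>2 + (Im ?z)\<^sup>2 = (cmod d)\<^sup>2" using re by (metis cmod_power2)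
    then have "\<bar>Im ?z\<bar> = q" by (simp add: q_def flip: real_sqrt_abs)
    then have "?z = Complex h q \<or> ?z = Complex h (- q)" using re by (auto simp: complex_eq_iff)
    then show ?thesis using assms(1) by (auto simp: field_simps)
  qed
  then show ?thesis by (blast intro: finite_subset[of _ "{Complex h q / cnj d, Complex h (- q) / cnj d}"])
qed

lemma infinite_unit_circle: "infinite {u :: complex. cmod u = 1}"
proof
  assume fin: "finite {u :: complex. cmod u = 1}"
  have "inj_on cis {0<..<1}"
  proof (rule inj_onI)
    fix x y :: real assume "x \<in> {0<..<1}" "y \<in> {0<..<1}" "cis x = cis y"
    then show "x = y" using cos_inj_pi[of x y] pi_gt3 by (auto simp: complex_eq_iff)
  qed
  moreover have "cis ` {0<..<1} \<subseteq> {u. cmod u = 1}" by auto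
  ultimately have "finite {0<..<1::real}" using fin finite_subset inj_on_finite by blast
  then show False using infinite_Ioo[of 0 "1::real"] by simp
qed

text \<open>Each condition excludes only finitely many unit vectors. The case \<open>i = i'\<close>
  is left out of the first condition because a point of a circle always has the radius as its
  distance from the centre.\<close>

lemma generic_direction:
  fixes p :: "'i \<Rightarrow> complex" and r :: "'i \<Rightarrow> real"
  assumes X: "finite X" "inj_on p X" "\<And>i. i \<in> X \<Longrightarrow> 0 < r i"
  shows "\<exists>u. cmod u = 1 \<and>
     (\<forall>i \<in> X. \<forall>i' \<in> X. i \<noteq> i' \<longrightarrow> cmod (p i + of_real (r i) * u - p i') \<noteq> r i') \<and>
     (\<forall>i \<in> X. \<forall>i' \<in> X. p i + of_real (r i) * u \<noteq> p i')"
proof -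
  let ?B1 = "\<lambda>i i'. {u. cmod u = 1 \<and> cmod (p i - p i' + of_real (r i) * u) = r i'}"
  let ?B2 = "\<lambda>i i'. {u. p i + of_real (r i) * u = p i'}"
  have "finite (?B1 i i')" if "i \<in> X" "i' \<in> X - {i}" for i i'
    using that X by (intro finite_circle_intersection) (auto simp: inj_on_def)
  moreover have "?B2 i i' \<subseteq> {(p i' - p i) / of_real (r i)}" if "i \<in> X" for i i'
    using X(3)[OF that] by (auto simp: field_simps)
  then have "finite (?B2 i i')" if "i \<in> X" for i i' using that by (meson finite.intros finite_subset)
  ultimately have "finite ((\<Union>i\<in>X. \<Union>i'\<in>X - {i}. ?B1 i i') \<union> (\<Union>i\<in>X. \<Union>i'\<in>X. ?B2 i i'))"
    using X(1) by blast
  then obtain u where "cmod u = 1"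
      "u \<notin> (\<Union>i\<in>X. \<Union>i'\<in>X - {i}. ?B1 i i') \<union> (\<Union>i\<in>X. \<Union>i'\<in>X. ?B2 i i')"
  proof -
    fix B :: "complex set" assume B: "finite B" and ex: "\<And>u. cmod u = 1 \<Longrightarrow> u \<notin> B \<Longrightarrow> thesis"
    have "{u. cmod u = 1} - B \<noteq> {}"
      using Diff_infinite_finite[OF B infinite_unit_circle] infinite_imp_nonempty by blast
    then show thesis using ex by blast
  qed
  then show ?thesis by (intro exI[of _ u]) (auto simp: algebra_simps)
qed

text \<open>The data of one step: the given circles, a direction whose points avoid the other
  circles and all centres, and the lines along which copies are placed. \<open>off_circle\<close>
  keeps unintended tangencies from being forced, and \<open>off_centre\<close> keeps centres
  apart.\<close>

locale tangent_lines =
  fixes X :: "nat set" and p :: "nat \<Rightarrow> complex" and r :: "nat \<Rightarrow> real" and u :: complex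
    and N :: nat and L :: "nat option list set"
  assumes finX: "finite X" and r_pos: "\<And>i. i \<in> X \<Longrightarrow> 0 < r i" and p_inj: "inj_on p X"
    and norm_u: "cmod u = 1"
    and off_circle: "\<And>i i'. \<lbrakk>i \<in> X; i' \<in> X; i \<noteq> i'\<rbrakk> \<Longrightarrow> cmod (p i + of_real (r i) * u - p i') \<noteq> r i'"
    and off_centre: "\<And>i i'. \<lbrakk>i \<in> X; i' \<in> X\<rbrakk> \<Longrightarrow> p i + of_real (r i) * u \<noteq> p i'"
    and L: "L \<subseteq> templates N X"
begin

definition pt :: "nat \<Rightarrow> complex" where
  "pt i = p i + of_real (r i) * u"

text \<open>\<open>Inl w\<close> stands for the new circle at the word \<open>w\<close>, and \<open>Inr (l, i)\<close> for the \<open>i\<close>-th circle in the copy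
  carried by the line \<open>l\<close>. Before the shift by \<open>\<rho>\<close>, centres are linear in the weights with coefficients
  \<open>coef\<close>, and radii are absolute values of linear forms with coefficients \<open>rcoef\<close>.\<close>

fun coef :: "nat list + nat option list \<times> nat \<Rightarrow> nat \<Rightarrow> complex" where
  "coef (Inl w) j = pt (w ! j)"
| "coef (Inr (l, i)) j = (case l ! j of None \<Rightarrow> p i | Some b \<Rightarrow> pt b)"

fun rcoef :: "nat list + nat option list \<times> nat \<Rightarrow> nat \<Rightarrow> complex" where
  "rcoef (Inl w) j = 0"
| "rcoef (Inr (l, i)) j = (if l ! j = None then of_real (r i) else 0)"

definition verts :: "(nat list + nat option list \<times> nat) set" where
  "verts = Inl ` (\<Union>l\<in>L. subst l ` X) \<union> Inr ` (L \<times> X)"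

text \<open>The pairs whose position is prescribed: circles in one copy, and a new circle with its
  matched circle in a copy. All other pairs are kept from tangency by genericity.\<close>

fun related :: "nat list + nat option list \<times> nat \<Rightarrow> nat list + nat option list \<times> nat \<Rightarrow> bool" where
  "related (Inl w) (Inl w') = False"
| "related (Inl w) (Inr (l, i)) = (w = subst l i)"
| "related (Inr (l, i)) (Inl w) = (w = subst l i)"
| "related (Inr (l, i)) (Inr (l', i')) = (l = l')"

lemma finite_verts: "finite verts"
  unfolding verts_def using finX finite_subset[OF L finite_templates[OF finX]] by auto

lemma pt_inj: "i \<in> X \<Longrightarrow> i' \<in> X \<Longrightarrow> pt i = pt i' \<longleftrightarrow> i = i'"
proof -
  assume i: "i \<in> X" "i' \<in> X"
  have "cmod (pt i' - p i') = r i'" using norm_u r_pos[OF i(2)] by (simp add: pt_def norm_mult)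
  then show ?thesis using off_circle[OF i] by (metis pt_def)
qed

lemma template_nth: "l \<in> L \<Longrightarrow> j < N \<Longrightarrow> l ! j = Some b \<Longrightarrow> b \<in> X"
  using L nth_mem[of j l] by (force simp: templates_def)

lemma template_length: "l \<in> L \<Longrightarrow> length l = N"
  using L by (auto simp: templates_def)

lemma template_active: "l \<in> L \<Longrightarrow> \<exists>j<N. l ! j = None"
  using L by (force simp: templates_def in_set_conv_nth)

lemma template_neq: "l \<in> L \<Longrightarrow> l' \<in> L \<Longrightarrow> l \<noteq> l' \<Longrightarrow> \<exists>j<N. l ! j \<noteq> l' ! j"
  using template_length by (metis nth_equalityI)

lemma word_nth: "Inl w \<in> verts \<Longrightarrow> length w = N \<and> (\<forall>j<N. w ! j \<in> X)"
proof -
  assume "Inl w \<in> verts"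
  then have "w \<in> words N X" using subst_words[OF subsetD[OF L]] by (auto simp: verts_def)
  then show ?thesis using nth_mem by (fastforce simp: words_def)
qed

lemma word_neq: "Inl w \<in> verts \<Longrightarrow> length w' = N \<Longrightarrow> w \<noteq> w' \<Longrightarrow> \<exists>j<N. w ! j \<noteq> w' ! j"
  using word_nth by (metis nth_equalityI)

lemma Inr_verts [simp]: "Inr (l, i) \<in> verts \<longleftrightarrow> l \<in> L \<and> i \<in> X"
  by (auto simp: verts_def)

text \<open>At an active coordinate a word contributes some \<open>pt\<close> and a copy a centre,
  which \<open>off_centre\<close> separates. Other pairs differ where their words or templates do
  or, within one copy, by \<open>p_inj\<close>.\<close>

lemma coef_differ:
  assumes "v \<in> verts" "v' \<in> verts" "v \<noteq> v'"
  shows "\<exists>j<N. coef v j \<noteq> coef v' j"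
proof -
  have wl: "\<exists>j<N. coef (Inl w) j \<noteq> coef (Inr (l, i)) j" if wli: "Inl w \<in> verts" "l \<in> L" "i \<in> X" for w l i
  proof -
    obtain j where "j < N" "l ! j = None" using template_active[OF wli(2)] by blast
    then show ?thesis using off_centre[of "w ! j" i] word_nth wli by (auto simp: pt_def)
  qed
  show ?thesis
  proof (cases v; cases v')
    fix w w' assume *: "v = Inl w" "v' = Inl w'"
    then obtain j where "j < N" "w ! j \<noteq> w' ! j" using word_neq word_nth assms by blast
    then show ?thesis using * assms word_nth pt_inj by auto
  next
    fix w b assume "v = Inl w" "v' = Inr b"
    then show ?thesis using wl assms by (cases b) auto
  next
    fix w b assume *: "v' = Inl w" "v = Inr b"
    then have "\<exists>j<N. coef v' j \<noteq> coef v j" using wl assms by (cases b) auto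
    then show ?thesis by metis
  next
    fix b b' assume *: "v = Inr b" "v' = Inr b'"
    obtain l i l' i' where b: "b = (l, i)" "b' = (l', i')" by (cases b, cases b')
    have m: "l \<in> L" "l' \<in> L" "i \<in> X" "i' \<in> X" using * b assms by auto
    show ?thesis
    proof (cases "l = l'")
      case True
      obtain j where "j < N" "l ! j = None" using template_active[OF m(1)] by blast
      then show ?thesis using * b True assms m p_inj by (auto simp: inj_on_def)
    next
      case False
      obtain j where j: "j < N" "l ! j \<noteq> l' ! j" using template_neq[OF m(1,2) False] by blast
      then have "coef v j \<noteq> coef v' j"
        using * b m template_nth[of l j] template_nth[of l' j] pt_inj off_centre
        by (cases "l ! j"; cases "l' ! j") (auto simp: pt_def, metis)
      then show ?thesis using j by blast
    qed
  qed
qed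

text \<open>The \<open>gap\<close> of two circles at shift \<open>\<rho> = 0\<close>, as a function
  of the weights.\<close>

definition vgap :: "nat list + nat option list \<times> nat \<Rightarrow> nat list + nat option list \<times> nat \<Rightarrow> (nat \<Rightarrow> complex) \<Rightarrow> real" where
  "vgap v v' x = gap ((cmod (linear_form N (\<lambda>j. coef v j - coef v' j) x))\<^sup>2)
     ((cmod (linear_form N (rcoef v) x))\<^sup>2) ((cmod (linear_form N (rcoef v') x))\<^sup>2)"

lemma line_polynomial_vgap: "line_polynomial (vgap v v')"
  unfolding vgap_def gap_def power2_eq_square[of "_ - _"]
  by (intro line_polynomial_diff line_polynomial_mult line_polynomial_const line_polynomial_cmod)

lemma vgap_commute: "vgap v v' = vgap v' v"
proof
  fix x
  have "linear_form N (\<lambda>j. coef v j - coef v' j) x = - linear_form N (\<lambda>j. coef v' j - coef v j) x"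
    unfolding linear_form_def by (simp add: sum_negf[symmetric] algebra_simps)
  then show "vgap v v' x = vgap v' v x"
    by (simp add: vgap_def gap_def algebra_simps)
qed

lemma vgap_single:
  assumes "j < N" "vgap v v' (\<lambda>k. if k = j then 1 else 0) = 0"
  shows "gap ((cmod (coef v j - coef v' j))\<^sup>2) ((cmod (rcoef v j))\<^sup>2) ((cmod (rcoef v' j))\<^sup>2) = 0"
  using assms by (simp add: vgap_def linear_form_single)

lemma vgap_double:
  assumes "j < N" "k < N" "j \<noteq> k" "\<And>x. vgap v v' x = 0"
  shows "gap ((cmod (\<alpha> * (coef v j - coef v' j) + \<beta> * (coef v k - coef v' k)))\<^sup>2)
     ((cmod (\<alpha> * rcoef v j + \<beta> * rcoef v k))\<^sup>2) ((cmod (\<alpha> * rcoef v' j + \<beta> * rcoef v' k))\<^sup>2) = 0"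
  using assms(4)[of "\<lambda>i. if i = j then \<alpha> else if i = k then \<beta> else 0"] assms(1-3)
  by (simp add: vgap_def linear_form_double)

lemma gap_pt_pt: "i \<in> X \<Longrightarrow> i' \<in> X \<Longrightarrow> gap ((cmod (pt i - pt i'))\<^sup>2) 0 0 = 0 \<Longrightarrow> i = i'"
  using pt_inj by (simp add: gap_def)

lemma gap_pt_circle:
  assumes "i \<in> X" "i' \<in> X" "gap ((cmod (pt i - p i'))\<^sup>2) 0 ((r i')\<^sup>2) = 0"
  shows "i = i'"
proof (rule ccontr)
  assume "i \<noteq> i'"
  have "(cmod (pt i - p i'))\<^sup>2 = (r i')\<^sup>2" using assms(3) by (simp add: gap_def)
  then have "cmod (pt i - p i') = r i'" using r_pos[OF assms(2)] by (simp add: power2_eq_iff_nonneg)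
  then show False using off_circle[OF assms(1,2) \<open>i \<noteq> i'\<close>] by (simp add: pt_def)
qed

text \<open>Weight on a single coordinate where \<open>w\<close> departs from
  \<open>subst l i\<close> tests a point against the \<open>i\<close>-th circle if the coordinate is
  active in \<open>l\<close>, and two points against each other if it is not.\<close>

lemma vgap_word_circle:
  assumes "Inl w \<in> verts" "l \<in> L" "i \<in> X" and zero: "\<And>x. vgap (Inl w) (Inr (l, i)) x = 0"
  shows "w = subst l i"
proof (rule ccontr)
  assume "w \<noteq> subst l i"
  then obtain j where j: "j < N" "w ! j \<noteq> subst l i ! j"
    using word_neq[OF assms(1), of "subst l i"] template_length assms by auto
  have wX: "w ! j \<in> X" using word_nth assms(1) j by blast
  have g: "gap ((cmod (pt (w ! j) - coef (Inr (l, i)) j))\<^sup>2) 0 ((cmod (rcoef (Inr (l, i)) j))\<^sup>2) = 0"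
    using vgap_single[OF j(1) zero] by simp
  have "w ! j = subst l i ! j"
  proof (cases "l ! j")
    case None
    then show ?thesis using g gap_pt_circle[OF wX assms(3)] j template_length[OF assms(2)]
      by (simp add: nth_subst)
  next
    case (Some b)
    then show ?thesis using g gap_pt_pt[OF wX] template_nth[OF assms(2) j(1)] j template_length[OF assms(2)]
      by (simp add: nth_subst)
  qed
  then show False using j by blast
qed

text \<open>Let the quartic vanish identically. Testing it on single coordinates forces the two templates
  to agree outside their active sets. The mixed coordinates are then refuted by pairs of weights.\<close>

lemma vgap_circle_circle_aux:
  assumes L': "l \<in> L" "l' \<in> L" "i \<in> X" "i' \<in> X"
    and zero: "\<And>x. vgap (Inr (l, i)) (Inr (l', i')) x = 0"
    and j: "j < N" "l ! j \<noteq> None" "l' ! j = None"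
  shows False
proof -
  note single = vgap_single[OF _ zero]
  \<comment> \<open>Weight on \<open>j\<close> alone puts the point of the fixed letter on the
    circle \<open>i'\<close>, so that letter is \<open>i'\<close>.\<close>
  have lj: "l ! j = Some i'"
  proof -
    obtain b where b: "l ! j = Some b" using j by blast
    then have "b = i'"
      using single[OF j(1)] gap_pt_circle[OF template_nth[OF L'(1) j(1) b] L'(4)] j by simp
    then show ?thesis using b by simp
  qed
  obtain k where k: "k < N" "l ! k = None" using template_active[OF L'(1)] by blast
  have "k \<noteq> j" using k j by auto
  note double = vgap_double[OF k(1) j(1) this zero]
  have r: "0 < r i" "0 < r i'" using r_pos L' by auto
  show False
  proof (cases "l' ! k")
    case (Some b)
    have "gap ((cmod (p i - pt b))\<^sup>2) ((r i)\<^sup>2) 0 = 0"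
      using single[OF k(1)] k Some by simp
    then have "b = i"
      using gap_pt_circle[OF template_nth[OF L'(2) k(1) Some] L'(3)]
      by (simp add: gap_commute[of _ _ 0] norm_minus_commute)
    \<comment> \<open>These weights scale both radii to 1 and put the two displacements at a right
      angle, so the squared distance is 2 and the gap is -4.\<close>
    then have "gap ((cmod (1 / of_real (r i) * (p i - pt i) + \<i> / of_real (r i') * (pt i' - p i')))\<^sup>2)
        ((cmod (1 / of_real (r i) * of_real (r i)))\<^sup>2) ((cmod (\<i> / of_real (r i') * of_real (r i')))\<^sup>2) = 0"
      using double[of "1 / of_real (r i)" "\<i> / of_real (r i')"] k j lj Some by simp
    moreover have "1 / of_real (r i) * (p i - pt i) + \<i> / of_real (r i') * (pt i' - p i') = (\<i> - 1) * u"
      using r by (simp add: pt_def field_simps)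
    moreover have "(cmod ((\<i> - 1) * u))\<^sup>2 = 2"
      using norm_u by (simp add: norm_mult cmod_power2)
    ultimately show False using r by (simp add: gap_def)
  next
    case None
    have D: "gap ((cmod (\<alpha> * (p i - p i') + \<beta> * (pt i' - p i')))\<^sup>2)
        ((cmod (\<alpha> * of_real (r i)))\<^sup>2) ((cmod (\<alpha> * of_real (r i') + \<beta> * of_real (r i')))\<^sup>2) = 0" for \<alpha> \<beta>
      using double[of \<alpha> \<beta>] k j lj None by simp
    show False
    proof (cases "i = i'")
      case False
      \<comment> \<open>Weights 1 and -1 cancel the second radius and leave the point
        \<open>pt i'\<close> against the circle \<open>i\<close>.\<close>
      have "gap ((cmod (pt i' - p i))\<^sup>2) 0 ((r i)\<^sup>2) = 0"
        using D[of 1 "-1"] by (simp add: gap_commute[of _ _ 0] norm_minus_commute)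
      then show False using gap_pt_circle[OF L'(4,3)] False by blast
    next
      case True
      \<comment> \<open>Weights 1 and \<open>\<i>\<close> give a squared distance and squared radii
        in the ratio 1 : 1 : 2, where the gap is negative.\<close>
      have "cmod (of_real (r i') + \<i> * of_real (r i')) ^ 2 = 2 * (r i')\<^sup>2" by (simp add: cmod_power2)
      moreover have "(cmod (\<i> * (pt i' - p i')))\<^sup>2 = (r i')\<^sup>2"
        using norm_u by (simp add: pt_def norm_mult)
      ultimately have "gap ((r i')\<^sup>2) ((r i')\<^sup>2) (2 * (r i')\<^sup>2) = 0"
        using D[of 1 \<i>] True by simp
      then show False using r by (simp add: gap_def power2_eq_square)
    qed
  qed
qed

text \<open>The preceding lemma, applied in both orders, makes the active sets equal; weights on
  single coordinates then compare the fixed letters.\<close>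

lemma vgap_circle_circle:
  assumes L': "l \<in> L" "l' \<in> L" "i \<in> X" "i' \<in> X"
    and zero: "\<And>x. vgap (Inr (l, i)) (Inr (l', i')) x = 0"
  shows "l = l'"
proof (rule ccontr)
  assume "l \<noteq> l'"
  then obtain j where j: "j < N" "l ! j \<noteq> l' ! j" using template_neq[OF L'(1,2)] by blast
  have zero': "vgap (Inr (l', i')) (Inr (l, i)) x = 0" for x using zero by (metis vgap_commute)
  have "l ! j = None \<or> l' ! j \<noteq> None" using vgap_circle_circle_aux[OF L' zero j(1)] by blast
  moreover have "l' ! j = None \<or> l ! j \<noteq> None"
    using vgap_circle_circle_aux[OF L'(2,1,4,3) zero' j(1)] by blast
  ultimately obtain b b' where b: "l ! j = Some b" "l' ! j = Some b'" using j(2) by force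
  have "b = b'"
    using vgap_single[OF j(1) zero] b gap_pt_pt[of b b'] template_nth[OF L'(1) j(1)] template_nth[OF L'(2) j(1)]
    by simp
  then show False using b j(2) by simp
qed

lemma vgap_nontrivial:
  assumes "v \<in> verts" "v' \<in> verts" "v \<noteq> v'" "\<not> related v v'"
  shows "\<exists>x. vgap v v' x \<noteq> 0"
proof (rule ccontr)
  assume "\<not> ?thesis"
  then have zero: "vgap v v' x = 0" "vgap v' v x = 0" for x by (auto simp: vgap_commute[of v'])
  show False
  proof (cases v; cases v')
    fix w w' assume *: "v = Inl w" "v' = Inl w'"
    then obtain j where j: "j < N" "w ! j \<noteq> w' ! j" using word_neq word_nth assms by blast
    then show False using vgap_single[OF j(1) zero(1)] * gap_pt_pt word_nth assms by auto
  next
    fix w b assume "v = Inl w" "v' = Inr b"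
    then show False using vgap_word_circle[of w] zero assms by (cases b) auto
  next
    fix w b assume "v' = Inl w" "v = Inr b"
    then show False using vgap_word_circle[of w] zero assms by (cases b) auto
  next
    fix b b' assume "v = Inr b" "v' = Inr b'"
    then show False using vgap_circle_circle zero(1) assms by (cases b; cases b') auto
  qed
qed

section \<open>Generic weights and the shift by \<open>\<rho>\<close>\<close>

definition active :: "nat option list \<Rightarrow> nat \<Rightarrow> complex" where
  "active l j = (if l ! j = None then 1 else 0)"

text \<open>All conditions ask finitely many line polynomials, none identically zero, not to vanish;
  a complex linear form enters through its squared modulus.\<close>

lemma generic_weights:
  obtains x where "\<And>v v'. \<lbrakk>v \<in> verts; v' \<in> verts; v \<noteq> v'\<rbrakk> \<Longrightarrow>
      linear_form N (coef v) x \<noteq> linear_form N (coef v') x \<and> (\<not> related v v' \<longrightarrow> vgap v v' x \<noteq> 0)"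
    "\<And>l. l \<in> L \<Longrightarrow> linear_form N (active l) x \<noteq> 0"
proof -
  let ?U = "{(v, v') \<in> verts \<times> verts. v \<noteq> v' \<and> \<not> related v v'}"
  let ?D = "{(v, v') \<in> verts \<times> verts. v \<noteq> v'}"
  let ?Y = "(\<lambda>(v, v') j. coef v j - coef v' j) ` ?D \<union> active ` L"
  let ?I = "(\<lambda>(v, v'). vgap v v') ` ?U \<union> (\<lambda>y x. (cmod (linear_form N y x))\<^sup>2) ` ?Y"
  have fin: "finite ?I"
  proof (intro finite_UnI finite_imageI)
    show "finite ?U" "finite ?D"
      by (rule finite_subset[OF _ finite_cartesian_product[OF finite_verts finite_verts]], blast)+
    show "finite L" by (rule finite_subset[OF L finite_templates[OF finX]])
  qed
  have lp: "line_polynomial f" if "f \<in> ?I" for f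
    using that line_polynomial_vgap line_polynomial_cmod by auto
  have Y: "\<exists>x. linear_form N y x \<noteq> 0" if "y \<in> ?Y" for y
  proof -
    have "\<exists>j<N. y j \<noteq> 0"
      using that
    proof
      assume "y \<in> (\<lambda>(v, v') j. coef v j - coef v' j) ` ?D"
      then show ?thesis using coef_differ by auto
    next
      assume "y \<in> active ` L"
      then obtain l where l: "l \<in> L" "y = active l" by blast
      obtain j where "j < N" "l ! j = None" using template_active[OF l(1)] by blast
      then show ?thesis by (intro exI[of _ j]) (simp add: l(2) active_def)
    qed
    then obtain j where "j < N" "y j \<noteq> 0" by blast
    then show ?thesis by (metis linear_form_single mult_1)
  qed
  have nz: "\<exists>x. f x \<noteq> 0" if "f \<in> ?I" for f
    using that
  proof
    assume "f \<in> (\<lambda>(v, v'). vgap v v') ` ?U"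
    then show ?thesis using vgap_nontrivial by auto
  next
    assume "f \<in> (\<lambda>y x. (cmod (linear_form N y x))\<^sup>2) ` ?Y"
    then obtain y where "y \<in> ?Y" and f: "f = (\<lambda>x. (cmod (linear_form N y x))\<^sup>2)" by (rule imageE)
    then show ?thesis using Y by simp
  qed
  have "\<exists>x. \<forall>f \<in> ?I. f x \<noteq> 0" by (rule line_polynomial_generic[OF fin lp nz])
  then obtain x where x: "\<forall>f \<in> ?I. f x \<noteq> 0" ..
  have "linear_form N (coef v) x \<noteq> linear_form N (coef v') x \<and> (\<not> related v v' \<longrightarrow> vgap v v' x \<noteq> 0)"
    if "v \<in> verts" "v' \<in> verts" "v \<noteq> v'" for v v'
  proof
    have "(\<lambda>j. coef v j - coef v' j) \<in> ?Y" using that by (intro UnI1 rev_image_eqI[of "(v, v')"]) auto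
    then have "(\<lambda>x. (cmod (linear_form N (\<lambda>j. coef v j - coef v' j) x))\<^sup>2) \<in> ?I" by (rule imageI[THEN UnI2])
    then have "(cmod (linear_form N (\<lambda>j. coef v j - coef v' j) x))\<^sup>2 \<noteq> 0" by (rule bspec[OF x])
    moreover have "linear_form N (\<lambda>j. coef v j - coef v' j) x = linear_form N (coef v) x - linear_form N (coef v') x"
      by (simp add: linear_form_def algebra_simps sum_subtractf)
    ultimately show "linear_form N (coef v) x \<noteq> linear_form N (coef v') x" by auto
    show "\<not> related v v' \<longrightarrow> vgap v v' x \<noteq> 0"
    proof
      assume "\<not> related v v'"
      then have "vgap v v' \<in> ?I" using that by (intro UnI1 rev_image_eqI[of "(v, v')"]) auto
      then show "vgap v v' x \<noteq> 0" by (rule bspec[OF x])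
    qed
  qed
  moreover have "linear_form N (active l) x \<noteq> 0" if "l \<in> L" for l
  proof -
    have "(\<lambda>x. (cmod (linear_form N (active l) x))\<^sup>2) \<in> ?I" using that by (intro UnI2 imageI)
    then have "(cmod (linear_form N (active l) x))\<^sup>2 \<noteq> 0" by (rule bspec[OF x])
    then show ?thesis by auto
  qed
  ultimately show thesis by (rule that)
qed

text \<open>The linear form of \<open>active l\<close> is the similarity factor of the copy on
  \<open>l\<close>. Its \<open>sgn\<close> is the rotation of the copy, so the copy is shifted by
  length \<open>\<rho>\<close> against the rotated direction \<open>u\<close>.\<close>

fun centre :: "(nat \<Rightarrow> complex) \<Rightarrow> real \<Rightarrow> nat list + nat option list \<times> nat \<Rightarrow> complex" where
  "centre x \<rho> (Inl w) = linear_form N (coef (Inl w)) x"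
| "centre x \<rho> (Inr (l, i)) =
     linear_form N (coef (Inr (l, i))) x - of_real \<rho> * sgn (linear_form N (active l) x) * u"

fun radius :: "(nat \<Rightarrow> complex) \<Rightarrow> real \<Rightarrow> nat list + nat option list \<times> nat \<Rightarrow> real" where
  "radius x \<rho> (Inl w) = \<rho>"
| "radius x \<rho> (Inr (l, i)) = cmod (linear_form N (active l) x) * r i"

lemma rcoef_form: "linear_form N (rcoef (Inr (l, i))) x = linear_form N (active l) x * of_real (r i)"
  by (auto simp: linear_form_def active_def sum_distrib_right intro!: sum.cong)

text \<open>Fixed coordinates cancel, and the active ones together give the similarity
  factor.\<close>

lemma coef_diff_same:
  "linear_form N (coef (Inr (l, i))) x - linear_form N (coef (Inr (l, i'))) x
     = linear_form N (active l) x * (p i - p i')"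
  unfolding linear_form_def active_def sum_distrib_right sum_subtractf[symmetric]
  by (intro sum.cong) (auto simp: algebra_simps split: option.splits)

lemma coef_diff_incident:
  assumes "l \<in> L"
  shows "linear_form N (coef (Inl (subst l i))) x - linear_form N (coef (Inr (l, i))) x
     = linear_form N (active l) x * (of_real (r i) * u)"
  unfolding linear_form_def active_def sum_distrib_right sum_subtractf[symmetric]
  using template_length[OF assms]
  by (intro sum.cong) (auto simp: algebra_simps nth_subst pt_def split: option.splits)

lemma dist_same:
  "dist (centre x \<rho> (Inr (l, i))) (centre x \<rho> (Inr (l, i'))) = cmod (linear_form N (active l) x) * dist (p i) (p i')"
  using coef_diff_same[of l i x i'] by (simp add: dist_norm flip: norm_mult)

text \<open>Before the shift the point of the word lies on the matched circle. The shift moves the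
  centre of that circle away along this radius, so the two lengths add.\<close>

lemma dist_incident:
  assumes "l \<in> L" "i \<in> X" "0 < \<rho>" "linear_form N (active l) x \<noteq> 0"
  shows "dist (centre x \<rho> (Inl (subst l i))) (centre x \<rho> (Inr (l, i)))
     = radius x \<rho> (Inl (subst l i)) + radius x \<rho> (Inr (l, i))"
proof -
  let ?t = "linear_form N (active l) x"
  have t: "?t = of_real (cmod ?t) * sgn ?t" using assms(4) by (simp add: sgn_eq)
  have "centre x \<rho> (Inl (subst l i)) - centre x \<rho> (Inr (l, i)) = ?t * (of_real (r i) * u) + of_real \<rho> * sgn ?t * u"
    using coef_diff_incident[OF assms(1), of i x] by (simp add: algebra_simps)
  also have "\<dots> = of_real (cmod ?t * r i + \<rho>) * (sgn ?t * u)"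
    by (subst (1) t) (simp add: algebra_simps)
  finally show ?thesis
    using assms r_pos[OF assms(2)] norm_u by (simp add: dist_norm norm_mult norm_sgn del: of_real_add of_real_mult)
qed

text \<open>At \<open>\<rho> = 0\<close> the conditions are those on the weights, with
  \<open>vgap\<close> as the gap; they are finitely many and persist for small positive
  \<open>\<rho>\<close> by continuity.\<close>

lemma generic_radius:
  assumes x: "\<And>v v'. v \<in> verts \<Longrightarrow> v' \<in> verts \<Longrightarrow> v \<noteq> v' \<Longrightarrow> linear_form N (coef v) x \<noteq> linear_form N (coef v') x \<and>
         (\<not> related v v' \<longrightarrow> vgap v v' x \<noteq> 0)"
  shows "\<exists>\<rho>>0. \<forall>v \<in> verts. \<forall>v' \<in> verts. v \<noteq> v' \<longrightarrow> centre x \<rho> v \<noteq> centre x \<rho> v' \<and>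
    (\<not> related v v' \<longrightarrow> gap ((dist (centre x \<rho> v) (centre x \<rho> v'))\<^sup>2) ((radius x \<rho> v)\<^sup>2) ((radius x \<rho> v')\<^sup>2) \<noteq> 0)"
proof -
  have contc: "continuous_on UNIV (\<lambda>\<rho>. centre x \<rho> v)" for v
  proof (cases v)
    case (Inr b) then show ?thesis by (cases b) (auto intro!: continuous_intros)
  qed auto
  have contr: "continuous_on UNIV (\<lambda>\<rho>. radius x \<rho> v)" for v
  proof (cases v)
    case (Inr b) then show ?thesis by (cases b) (auto intro!: continuous_intros)
  qed (auto intro!: continuous_intros)
  have c0: "centre x 0 v = linear_form N (coef v) x" for v
    by (cases "(x, 0::real, v)" rule: centre.cases) auto
  have r0: "(radius x 0 v)\<^sup>2 = (cmod (linear_form N (rcoef v) x))\<^sup>2" for v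
  proof (cases v)
    case (Inl w) then show ?thesis by (simp add: linear_form_def)
  next
    case (Inr b) then show ?thesis by (cases b) (auto simp: rcoef_form norm_mult power_mult_distrib)
  qed
  let ?P = "\<lambda>\<rho> v v'. centre x \<rho> v \<noteq> centre x \<rho> v' \<and>
    (\<not> related v v' \<longrightarrow> gap ((dist (centre x \<rho> v) (centre x \<rho> v'))\<^sup>2) ((radius x \<rho> v)\<^sup>2) ((radius x \<rho> v')\<^sup>2) \<noteq> 0)"
  have ev0: "\<forall>\<^sub>F \<rho> in at_right 0. f \<rho> \<noteq> 0" if "continuous_on UNIV f" "f 0 \<noteq> 0" for f :: "real \<Rightarrow> real"
  proof -
    have "(f \<longlongrightarrow> f 0) (at 0 within UNIV)" using that(1) by (auto simp: continuous_on_def)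
    then have "(f \<longlongrightarrow> f 0) (at_right 0)" by (rule tendsto_within_subset) simp
    then show ?thesis using that(2) by (rule tendsto_imp_eventually_ne)
  qed
  have ev: "\<forall>\<^sub>F \<rho> in at_right 0. ?P \<rho> v v'" if "v \<in> verts" "v' \<in> verts" "v \<noteq> v'" for v v'
  proof -
    have "\<forall>\<^sub>F \<rho> in at_right 0. dist (centre x \<rho> v) (centre x \<rho> v') \<noteq> 0"
      using x[OF that] by (intro ev0 continuous_intros contc) (simp add: c0)
    moreover have "\<forall>\<^sub>F \<rho> in at_right 0. \<not> related v v' \<longrightarrow>
        gap ((dist (centre x \<rho> v) (centre x \<rho> v'))\<^sup>2) ((radius x \<rho> v)\<^sup>2) ((radius x \<rho> v')\<^sup>2) \<noteq> 0"
    proof (cases "related v v'")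
      case False
      have "vgap v v' x = gap ((dist (centre x 0 v) (centre x 0 v'))\<^sup>2) ((radius x 0 v)\<^sup>2) ((radius x 0 v')\<^sup>2)"
        unfolding vgap_def c0 r0 by (simp add: dist_norm linear_form_def algebra_simps sum_subtractf)
      then have "\<forall>\<^sub>F \<rho> in at_right 0.
          gap ((dist (centre x \<rho> v) (centre x \<rho> v'))\<^sup>2) ((radius x \<rho> v)\<^sup>2) ((radius x \<rho> v')\<^sup>2) \<noteq> 0"
        using x[OF that] False
        by (intro ev0) (auto simp: gap_def intro!: continuous_intros contc contr)
      then show ?thesis by (rule eventually_mono) simp
    qed simp
    ultimately show ?thesis by eventually_elim auto
  qed
  have "\<forall>\<^sub>F \<rho> in at_right (0::real). 0 < \<rho> \<and> (\<forall>v \<in> verts. \<forall>v' \<in> verts. v \<noteq> v' \<longrightarrow> ?P \<rho> v v')"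
  proof (intro eventually_conj eventually_ball_finite[OF finite_verts] ballI)
    show "\<forall>\<^sub>F \<rho> in at_right (0::real). 0 < \<rho>" by (simp add: eventually_at_right_less)
    fix v v' assume "v \<in> verts" "v' \<in> verts"
    then show "\<forall>\<^sub>F \<rho> in at_right 0. v \<noteq> v' \<longrightarrow> ?P \<rho> v v'" using ev by (cases "v = v'") auto
  qed
  then show ?thesis using eventually_happens[of _ "at_right (0::real)"] by (auto simp: trivial_limit_at_right_real)
qed

end

section \<open>The Tutte step\<close>

definition touching :: "'v set \<Rightarrow> ('v \<Rightarrow> complex) \<Rightarrow> ('v \<Rightarrow> real) \<Rightarrow> 'v set set" where
  "touching V c R = {{v, w} | v w. v \<in> V \<and> w \<in> V \<and> v \<noteq> w \<and> dist (c v) (c w) = R v + R w}"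

lemma touchingI:
  "dist (c v) (c w) = R v + R w \<Longrightarrow> v \<in> V \<Longrightarrow> w \<in> V \<Longrightarrow> v \<noteq> w \<Longrightarrow> {v, w} \<in> touching V c R"
  by (auto simp: touching_def)

text \<open>The invariant of the induction on \<open>k\<close>. Colourings are bounded on all
  labels, so for \<open>k = 0\<close> there are none and the last clause, that \<open>k\<close>
  colours do not suffice, holds trivially.\<close>

definition circle_system :: "nat \<Rightarrow> nat \<Rightarrow> 'v set \<Rightarrow> ('v \<Rightarrow> complex) \<Rightarrow> ('v \<Rightarrow> real) \<Rightarrow> bool" where
  "circle_system g k V c R \<longleftrightarrow> finite V \<and> V \<noteq> {} \<and> (\<forall>v \<in> V. 0 < R v) \<and> inj_on c V \<and>
     (\<forall>v \<in> V. \<forall>w \<in> V. v \<noteq> w \<longrightarrow> dist (c v) (c w) \<noteq> \<bar>R v - R w\<bar>) \<and>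
     edge_sparse g (\<lambda>e. e) (touching V c R) \<and>
     (\<forall>\<kappa> :: 'v \<Rightarrow> nat. (\<forall>v. \<kappa> v < k) \<longrightarrow> (\<exists>v w. {v, w} \<in> touching V c R \<and> \<kappa> v = \<kappa> w))"

text \<open>Each step produces labels of a new type; renaming them by natural numbers lets the step
  be iterated.\<close>

lemma circle_system_to_nat:
  fixes V :: "'v :: countable set"
  assumes "circle_system g k V c R"
  shows "circle_system g k (to_nat ` V) (c \<circ> from_nat) (R \<circ> from_nat)"
proof -
  have t: "touching (to_nat ` V) (c \<circ> from_nat) (R \<circ> from_nat) = (\<lambda>e. to_nat ` e) ` touching V c R"
  proof (intro equalityI subsetI)
    fix e assume "e \<in> touching (to_nat ` V) (c \<circ> from_nat) (R \<circ> from_nat)"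
    then obtain v w where "v \<in> V" "w \<in> V" "v \<noteq> w" "dist (c v) (c w) = R v + R w" "e = {to_nat v, to_nat w}"
      unfolding touching_def by auto
    then show "e \<in> (\<lambda>e. to_nat ` e) ` touching V c R"
      unfolding touching_def by (intro rev_image_eqI[of "{v, w}"]) auto
  next
    fix e assume "e \<in> (\<lambda>e. to_nat ` e) ` touching V c R"
    then obtain v w where "v \<in> V" "w \<in> V" "v \<noteq> w" "dist (c v) (c w) = R v + R w" "e = {to_nat v, to_nat w}"
      unfolding touching_def by auto
    then show "e \<in> touching (to_nat ` V) (c \<circ> from_nat) (R \<circ> from_nat)"
      unfolding touching_def by (intro CollectI exI[of _ "to_nat v"] exI[of _ "to_nat w"]) auto
  qed
  have "edge_sparse g (\<lambda>e. e) (touching V c R)" using assms by (simp add: circle_system_def)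
  then have "edge_sparse g (\<lambda>e. to_nat ` e) (touching V c R)" by (rule sparse_image) (simp add: inj_on_def)
  then have sp: "edge_sparse g (\<lambda>e. e) (touching (to_nat ` V) (c \<circ> from_nat) (R \<circ> from_nat))"
    unfolding t by (rule sparse_reindex)
  have "\<exists>v w. {v, w} \<in> touching (to_nat ` V) (c \<circ> from_nat) (R \<circ> from_nat) \<and> \<kappa> v = \<kappa> w"
    if "\<forall>v. \<kappa> v < k" for \<kappa> :: "nat \<Rightarrow> nat"
  proof -
    have "\<forall>v. (\<kappa> \<circ> (to_nat :: 'v \<Rightarrow> nat)) v < k" using that by simp
    moreover have "\<forall>\<kappa> :: 'v \<Rightarrow> nat. (\<forall>v. \<kappa> v < k) \<longrightarrow> (\<exists>v w. {v, w} \<in> touching V c R \<and> \<kappa> v = \<kappa> w)"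
      using assms unfolding circle_system_def by (elim conjE)
    ultimately obtain v w where vw: "{v, w} \<in> touching V c R" "(\<kappa> \<circ> to_nat) v = (\<kappa> \<circ> to_nat) w"
      by meson
    have "{to_nat v, to_nat w} \<in> touching (to_nat ` V) (c \<circ> from_nat) (R \<circ> from_nat)"
      unfolding t by (rule rev_image_eqI[OF vw(1)]) simp
    then show ?thesis using vw(2) by auto
  qed
  then show ?thesis using assms sp by (auto simp: circle_system_def inj_on_def)
qed

text \<open>The gadget is the old tangency graph on the \<open>Inr\<close> labels with a pendant
  vertex \<open>Inl i\<close> at each \<open>Inr i\<close>; the pendant vertices become the new
  circles, which copies may share.\<close>

fun gadget_copy :: "nat option list \<Rightarrow> nat + nat \<Rightarrow> nat list + nat option list \<times> nat" where
  "gadget_copy l (Inl i) = Inl (subst l i)"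
| "gadget_copy l (Inr i) = Inr (l, i)"

lemma circle_system_step:
  fixes X :: "nat set"
  assumes S: "circle_system (Suc (Suc g)) k X p r"
  shows "\<exists>V c R. circle_system (Suc (Suc g)) (Suc k) (V :: nat set) c R"
proof -
  let ?g = "Suc (Suc g)"
  have X: "finite X" "X \<noteq> {}" "\<And>i. i \<in> X \<Longrightarrow> 0 < r i" "inj_on p X"
    "\<And>i i'. i \<in> X \<Longrightarrow> i' \<in> X \<Longrightarrow> i \<noteq> i' \<Longrightarrow> dist (p i) (p i') \<noteq> \<bar>r i - r i'\<bar>"
    "edge_sparse ?g (\<lambda>e. e) (touching X p r)"
    using S by (auto simp: circle_system_def)
  have col: "\<exists>v w. {v, w} \<in> touching X p r \<and> \<kappa> v = \<kappa> w" if "\<forall>v. \<kappa> v < k" for \<kappa> :: "nat \<Rightarrow> nat"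
    using S that unfolding circle_system_def by blast
  obtain u where u: "cmod u = 1"
     "\<And>i i'. \<lbrakk>i \<in> X; i' \<in> X; i \<noteq> i'\<rbrakk> \<Longrightarrow> cmod (p i + of_real (r i) * u - p i') \<noteq> r i'"
     "\<And>i i'. \<lbrakk>i \<in> X; i' \<in> X\<rbrakk> \<Longrightarrow> p i + of_real (r i) * u \<noteq> p i'"
    using generic_direction[of X p r, OF X(1,4,3)] by blast
  \<comment> \<open>Sparsity \<open>Suc g\<close> of the lines is enough, as the amalgamation below
    raises it by one.\<close>
  obtain N L where lines: "L \<subseteq> templates N X" "edge_sparse (Suc g) (\<lambda>m. subst m ` X) L"
    "\<And>\<kappa>. \<forall>w. \<kappa> w < Suc k \<Longrightarrow> \<exists>m \<in> L. mono_line \<kappa> X m"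
    using sparse_Hales_Jewett[OF X(1), of g "Suc k"] unfolding sparse_HJ_def by blast
  interpret tangent_lines X p r u N L
    by unfold_locales (use X u lines(1) in auto)
  obtain x where x: "\<And>v v'. v \<in> verts \<Longrightarrow> v' \<in> verts \<Longrightarrow> v \<noteq> v' \<Longrightarrow>
        linear_form N (coef v) x \<noteq> linear_form N (coef v') x \<and> (\<not> related v v' \<longrightarrow> vgap v v' x \<noteq> 0)"
      and t: "\<And>l. l \<in> L \<Longrightarrow> linear_form N (active l) x \<noteq> 0"
    by (rule generic_weights) blast
  obtain \<rho> where \<rho>: "0 < \<rho>" "\<And>v v'. \<lbrakk>v \<in> verts; v' \<in> verts; v \<noteq> v'\<rbrakk> \<Longrightarrow> centre x \<rho> v \<noteq> centre x \<rho> v'"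
    and ngap: "\<And>v v'. \<lbrakk>v \<in> verts; v' \<in> verts; v \<noteq> v'; \<not> related v v'\<rbrakk> \<Longrightarrow>
      gap ((dist (centre x \<rho> v) (centre x \<rho> v'))\<^sup>2) ((radius x \<rho> v)\<^sup>2) ((radius x \<rho> v')\<^sup>2) \<noteq> 0"
    using generic_radius[of x, OF x] by blast
  let ?c = "centre x \<rho>" and ?R = "radius x \<rho>"
  have R: "0 < ?R v" if "v \<in> verts" for v
  proof (cases v)
    case (Inr b) then show ?thesis using that t X(3) by (cases b) auto
  qed (use \<rho> in simp)
  note inc = dist_incident[OF _ _ \<rho>(1) t]
  have rel: "(\<exists>l \<in> L. \<exists>i \<in> X. {v, v'} = {Inl (subst l i), Inr (l, i)}) \<or>
      (\<exists>l \<in> L. \<exists>i \<in> X. \<exists>i' \<in> X. i \<noteq> i' \<and> v = Inr (l, i) \<and> v' = Inr (l, i'))"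
    if "v \<in> verts" "v' \<in> verts" "v \<noteq> v'" "related v v'" for v v'
    using that by (cases "(v, v')" rule: related.cases) auto
  have not_int: "dist (?c v) (?c v') \<noteq> \<bar>?R v - ?R v'\<bar>" if vv: "v \<in> verts" "v' \<in> verts" "v \<noteq> v'" for v v'
  proof (cases "related v v'")
    case False
    then show ?thesis using ngap[OF vv False] gap_eq_0 by blast
  next
    case True
    from rel[OF vv True] show ?thesis
    proof (elim disjE bexE conjE)
      fix l i assume li: "l \<in> L" "i \<in> X" "{v, v'} = {Inl (subst l i), Inr (l, i)}"
      then have "dist (?c v) (?c v') = ?R v + ?R v'"
        using inc[OF li(1,2) li(1)] by (auto simp: doubleton_eq_iff dist_commute simp del: centre.simps radius.simps)
      then show ?thesis using R[OF vv(1)] R[OF vv(2)] by linarith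
    next
      fix l i i' assume li: "l \<in> L" "i \<in> X" "i' \<in> X" "i \<noteq> i'" "v = Inr (l, i)" "v' = Inr (l, i')"
      have "\<bar>?R v - ?R v'\<bar> = cmod (linear_form N (active l) x) * \<bar>r i - r i'\<bar>"
        using li by (simp add: abs_mult flip: right_diff_distrib)
      then show ?thesis using dist_same[of x \<rho> l i i'] X(5)[OF li(2-4)] t[OF li(1)] li(5,6) by simp
    qed
  qed
  let ?pend = "(\<lambda>i. {Inl i, Inr i}) ` X"
  let ?copy = "(\<lambda>e. Inr ` e) ` touching X p r :: (nat + nat) set set"
  define D where "D = (?copy \<union> ?pend :: (nat + nat) set set)"
  have D_verts: "gadget_copy l ` d \<in> touching verts ?c ?R" if "l \<in> L" "d \<in> D" for l d
    using that(2) unfolding D_def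
  proof
    assume "d \<in> ?pend"
    then obtain i where i: "i \<in> X" "d = {Inl i, Inr i}" by blast
    have "Inl (subst l i) \<in> verts" "Inr (l, i) \<in> verts" using i \<open>l \<in> L\<close> by (auto simp: verts_def)
    then have "{Inl (subst l i), Inr (l, i)} \<in> touching verts ?c ?R"
      by (intro touchingI inc[OF \<open>l \<in> L\<close> i(1) \<open>l \<in> L\<close>]) auto
    then show ?thesis using i by simp
  next
    assume "d \<in> ?copy"
    then obtain i j where ij: "i \<in> X" "j \<in> X" "i \<noteq> j" "dist (p i) (p j) = r i + r j" "d = {Inr i, Inr j}"
      unfolding touching_def by auto
    have "dist (?c (Inr (l, i))) (?c (Inr (l, j))) = ?R (Inr (l, i)) + ?R (Inr (l, j))"
      unfolding dist_same using ij(4) by (simp add: distrib_left)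
    then have "{Inr (l, i), Inr (l, j)} \<in> touching verts ?c ?R"
      by (rule touchingI) (use ij \<open>l \<in> L\<close> in auto)
    then show ?thesis using ij by simp
  qed
  have touch_sub: "touching verts ?c ?R \<subseteq> (\<lambda>(l, d). gadget_copy l ` d) ` (L \<times> D)"
  proof
    fix e assume "e \<in> touching verts ?c ?R"
    then obtain v v' where e: "e = {v, v'}" and vv: "v \<in> verts" "v' \<in> verts" "v \<noteq> v'"
      and d: "dist (?c v) (?c v') = ?R v + ?R v'" unfolding touching_def by blast
    have "related v v'" using ngap[OF vv] gap_eq_0 d by blast
    from rel[OF vv this] show "e \<in> (\<lambda>(l, d). gadget_copy l ` d) ` (L \<times> D)"
    proof (elim disjE bexE conjE)
      fix l i assume li: "l \<in> L" "i \<in> X" "{v, v'} = {Inl (subst l i), Inr (l, i)}"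
      then show ?thesis using e by (intro rev_image_eqI[of "(l, {Inl i, Inr i})"]) (auto simp: D_def)
    next
      fix l i i' assume li: "l \<in> L" "i \<in> X" "i' \<in> X" "i \<noteq> i'" "v = Inr (l, i)" "v' = Inr (l, i')"
      have "dist (p i) (p i') = r i + r i'"
        using d dist_same[of x \<rho> l i i'] t[OF li(1)] li(5,6) by (simp flip: distrib_left)
      then have "{i, i'} \<in> touching X p r" by (rule touchingI) (use li in auto)
      then have "{Inr i, Inr i'} \<in> D" by (auto simp: D_def intro!: rev_image_eqI[of "{i, i'}"])
      then show ?thesis using e li by (intro rev_image_eqI[of "(l, {Inr i, Inr i'})"]) auto
    qed
  qed
  have spD: "edge_sparse ?g (\<lambda>d. d) D"
    unfolding edge_sparse_def
  proof (intro allI impI)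
    fix F assume F: "F \<subseteq> D" "finite F" "F \<noteq> {}" "card F \<le> ?g"
    show "\<exists>f\<in>F. \<exists>q. f \<inter> \<Union> ((\<lambda>d. d) ` (F - {f})) \<subseteq> {q}"
    proof (cases "F \<inter> ?pend = {}")
      case True
      have "edge_sparse ?g (\<lambda>e. Inr ` e :: (nat + nat) set) (touching X p r)"
        by (rule sparse_image[OF X(6)]) simp
      then have "edge_sparse ?g (\<lambda>d. d) ?copy"
        by (rule sparse_reindex[where e = "\<lambda>d. d" and h = "\<lambda>e. Inr ` e"])
      moreover have "F \<subseteq> ?copy" using True F(1) by (auto simp: D_def)
      ultimately show ?thesis using F by (meson sparseD)
    next
      \<comment> \<open>A pendant edge is a leaf, since no other edge contains its
        \<open>Inl\<close> end.\<close>
      case False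
      then obtain i where i: "{Inl i, Inr i} \<in> F" by blast
      have "Inl i \<notin> d" if "d \<in> F - {{Inl i, Inr i}}" for d
        using that F(1) by (auto simp: D_def)
      then have "{Inl i, Inr i} \<inter> \<Union> ((\<lambda>d. d) ` (F - {{Inl i, Inr i}})) \<subseteq> {Inr i}" by blast
      then show ?thesis using i by blast
    qed
  qed
  \<comment> \<open>Different copies share only new circles, and each gadget edge contains at most
    one of these.\<close>
  have "edge_sparse ?g (\<lambda>(l, d). gadget_copy l ` d) (L \<times> D)"
  proof (rule sparse_amalgam[where T = "Inl ` X"])
    have "edge_sparse (Suc g) (\<lambda>m. Inl ` subst m ` X :: (nat list + nat option list \<times> nat) set) L"
      by (rule sparse_image[OF lines(2)]) simp
    then show "edge_sparse (Suc g) (\<lambda>l. gadget_copy l ` Inl ` X) L" by (simp add: image_image)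
    show "edge_sparse ?g (\<lambda>d. d) D" by (rule spD)
    show "\<exists>q. d \<inter> Inl ` X \<subseteq> {q}" if "d \<in> D" for d
      using that by (auto simp: D_def)
    show "inj_on (gadget_copy l) (\<Union> ((\<lambda>d. d) ` D))" if "l \<in> L" for l
    proof (rule inj_onI)
      fix a b assume "gadget_copy l a = gadget_copy l b"
      then show "a = b" using subst_inj[of l N X] that lines(1) by (cases a; cases b) auto
    qed
    show "y \<in> Inl ` X \<and> y' \<in> Inl ` X"
      if "l \<in> L" "l' \<in> L" "l \<noteq> l'" "y \<in> \<Union> ((\<lambda>d. d) ` D)" "y' \<in> \<Union> ((\<lambda>d. d) ` D)"
        "gadget_copy l y = gadget_copy l' y'" for l l' y y'
      using that by (cases y; cases y') (auto simp: D_def touching_def)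
  qed simp
  then have "edge_sparse ?g (\<lambda>e. e) ((\<lambda>(l, d). gadget_copy l ` d) ` (L \<times> D))"
    by (rule sparse_reindex[where e = "\<lambda>e. e"])
  then have sp: "edge_sparse ?g (\<lambda>e. e) (touching verts ?c ?R)"
    by (rule sparse_subset[OF _ touch_sub])
  have colour: "\<exists>v w. {v, w} \<in> touching verts ?c ?R \<and> \<kappa> v = \<kappa> w" if \<kappa>: "\<forall>v. \<kappa> v < Suc k"
    for \<kappa> :: "nat list + nat option list \<times> nat \<Rightarrow> nat"
  proof -
    obtain l a where l: "l \<in> L" "\<And>i. i \<in> X \<Longrightarrow> \<kappa> (Inl (subst l i)) = a"
      using lines(3)[of "\<lambda>w. \<kappa> (Inl w)"] \<kappa> unfolding mono_line_def by blast
    show ?thesis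
    proof (cases "\<exists>i \<in> X. \<kappa> (Inr (l, i)) = a")
      case True
      then obtain i where i: "i \<in> X" "\<kappa> (Inr (l, i)) = a" by blast
      have "{Inl i, Inr i} \<in> D" using i by (simp add: D_def)
      then show ?thesis using D_verts[OF l(1), of "{Inl i, Inr i}"] i l(2) by auto
    next
      case False
      obtain i0 where i0: "i0 \<in> X" using X(2) by blast
      \<comment> \<open>The colour \<open>a\<close> is missing from the copy, so renaming
        \<open>k\<close> to \<open>a\<close> leaves only colours below \<open>k\<close>; if
        \<open>a = k\<close>, the colour \<open>k\<close> does not occur in the copy.\<close>
      define f where "f i = (if \<kappa> (Inr (l, i)) = k then a else \<kappa> (Inr (l, i)))" for i
      have a: "a \<le> k" using \<kappa> l(2)[OF i0] by (metis less_Suc_eq_le)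
      have fk: "f i < k" if "i \<in> X" for i
        using \<kappa>[rule_format, of "Inr (l, i)"] False that a unfolding f_def
        by (cases "a = k") (auto simp: less_Suc_eq)
      \<comment> \<open>\<open>i0\<close> extends the colouring to labels outside \<open>X\<close>,
        as the bound is demanded everywhere.\<close>
      obtain i j where ij: "{i, j} \<in> touching X p r"
          "f (if i \<in> X then i else i0) = f (if j \<in> X then j else i0)"
        using col[of "\<lambda>i. f (if i \<in> X then i else i0)"] fk i0 by auto
      have ijX: "i \<in> X" "j \<in> X" using ij(1) by (auto simp: touching_def doubleton_eq_iff)
      then have "\<kappa> (Inr (l, i)) = \<kappa> (Inr (l, j))"
        using ij(2) False by (auto simp: f_def split: if_splits)
      moreover have "{Inr i, Inr j} \<in> D"
        using ij(1) by (auto simp: D_def intro!: rev_image_eqI[of "{i, j}"])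
      ultimately show ?thesis using D_verts[OF l(1), of "{Inr i, Inr j}"] by auto
    qed
  qed
  have "verts \<noteq> {}"
    using lines(3)[of "\<lambda>_. 0"] X(2) by (auto simp: verts_def)
  then have "circle_system ?g (Suc k) verts ?c ?R"
    unfolding circle_system_def using finite_verts R \<rho>(2) not_int sp colour by (auto simp: inj_on_def)
  then show ?thesis using circle_system_to_nat by blast
qed

section \<open>Iterating the step, and girth from sparsity\<close>

lemma circle_system_exists: "\<exists>V c R. circle_system (Suc (Suc g)) k (V :: nat set) c R"
proof (induction k)
  case 0
  have "touching {0 :: nat} (\<lambda>_. 0) (\<lambda>_. 1) = {}" by (auto simp: touching_def)
  then have "circle_system (Suc (Suc g)) 0 {0 :: nat} (\<lambda>_. 0) (\<lambda>_. 1)"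
    by (auto simp: circle_system_def edge_sparse_def)
  then show ?case by blast
next
  case (Suc k)
  then show ?case using circle_system_step by blast
qed

text \<open>An edge of a cycle meets its two neighbours in its two different ends, so the edges of a
  cycle contain no leaf.\<close>

lemma sparse_imp_long_cycle:
  assumes sp: "edge_sparse g (\<lambda>e. e) E" and q: "3 \<le> length q" "distinct q"
    and edges: "\<And>i. i < length q \<Longrightarrow> {q ! i, q ! (Suc i mod length q)} \<in> E"
  shows "g < length q"
proof (rule ccontr)
  assume "\<not> g < length q"
  let ?n = "length q"
  let ?e = "\<lambda>i. {q ! i, q ! (Suc i mod ?n)}"
  let ?F = "?e ` {..<?n}"
  have "card ?F \<le> ?n" using card_image_le[of "{..<?n}" ?e] by simp
  then have cardF: "card ?F \<le> g" using \<open>\<not> g < ?n\<close> by linarith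
  have F: "?F \<subseteq> E" "finite ?F" "?F \<noteq> {}" using edges q(1) by (auto simp: lessThan_empty_iff)
  obtain f z where f: "f \<in> ?F" "f \<inter> \<Union> ((\<lambda>e. e) ` (?F - {f})) \<subseteq> {z}"
    by (rule sparseD[OF sp F cardF])
  then obtain i where i: "i < ?n" "f = ?e i" by blast
  \<comment> \<open>\<open>j\<close> and \<open>j'\<close> follow \<open>i\<close> cyclically and
    \<open>h\<close> precedes it; length at least 3 keeps the neighbouring edges different from
    \<open>f\<close>.\<close>
  define j where "j = Suc i mod ?n"
  define j' where "j' = Suc j mod ?n"
  define h where "h = (if i = 0 then ?n - 1 else i - 1)"
  have h: "h < ?n" "Suc h mod ?n = i" using i(1) q(1) by (auto simp: h_def)
  have "0 < ?n" using q(1) by linarith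
  then have j: "j < ?n" "j' < ?n" by (simp_all add: j_def j'_def)
  have ne: "i \<noteq> j" "j' \<noteq> i" "j' \<noteq> j" "h \<noteq> i" "h \<noteq> j"
    using i(1) q(1) by (auto simp: j_def j'_def h_def mod_Suc)
  have inj: "q ! a = q ! b \<longleftrightarrow> a = b" if "a < ?n" "b < ?n" for a b
    using that q(2) by (simp add: nth_eq_iff_index_eq)
  have f_eq: "f = {q ! i, q ! j}" using i by (simp add: j_def)
  have ej: "?e j = {q ! j, q ! j'}" and eh: "?e h = {q ! h, q ! i}" by (simp_all add: j'_def h(2))
  have "q ! j' \<noteq> q ! i" "q ! j' \<noteq> q ! j" "q ! h \<noteq> q ! i" "q ! h \<noteq> q ! j"
    using ne inj[OF j(2) i(1)] inj[OF j(2,1)] inj[OF h(1) i(1)] inj[OF h(1) j(1)] by simp_all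
  then have "?e j \<noteq> f" "?e h \<noteq> f" unfolding ej eh f_eq by (simp_all add: doubleton_eq_iff)
  then have "?e j \<in> ?F - {f}" "?e h \<in> ?F - {f}" using j h by auto
  moreover have "q ! j \<in> ?e j" "q ! i \<in> ?e h" using h by auto
  ultimately have "{q ! i, q ! j} \<subseteq> f \<inter> \<Union> ((\<lambda>e. e) ` (?F - {f}))" using f_eq by blast
  then have "{q ! i, q ! j} \<subseteq> {z}" using f(2) by (rule subset_trans)
  then have "q ! i = q ! j" by simp
  then show False using inj[OF i(1) j(1)] ne(1) by simp
qed

section \<open>Circles in the plane\<close>

text \<open>The points \<open>c + w\<close> and \<open>c - w\<close> of the line of centres,
  opposite on the first sphere, have different distances from \<open>c'\<close>.\<close>

lemma sphere_centre_unique: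
  fixes c c' :: "'a :: euclidean_space"
  assumes eq: "sphere c r = sphere c' s" and r: "0 < r" "0 < s"
  shows "c = c'"
proof (rule ccontr)
  assume "c \<noteq> c'"
  define w where "w = (r / dist c c') *\<^sub>R (c' - c)"
  have D: "0 < dist c c'" using \<open>c \<noteq> c'\<close> by simp
  have "norm w = r" using D r by (simp add: w_def dist_norm norm_minus_commute)
  then have "c + w \<in> sphere c r" "c - w \<in> sphere c r" by (auto simp: dist_norm)
  then have d: "dist c' (c + w) = s" "dist c' (c - w) = s" using eq by auto
  have "c' - (c + w) = (1 - r / dist c c') *\<^sub>R (c' - c)" "c' - (c - w) = (1 + r / dist c c') *\<^sub>R (c' - c)"
    by (auto simp: w_def algebra_simps)
  then have "\<bar>1 - r / dist c c'\<bar> * dist c c' = s" "\<bar>1 + r / dist c c'\<bar> * dist c c' = s"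
    using d by (auto simp: dist_norm norm_minus_commute)
  then have "\<bar>1 - r / dist c c'\<bar> = \<bar>1 + r / dist c c'\<bar>" using D by (metis mult_right_cancel less_irrefl)
  moreover have "0 < r / dist c c'" using D r by simp
  ultimately show False by linarith
qed

text \<open>The common point is fixed by the reflection in the line of centres.\<close>

lemma tangent_spheres_dist:
  fixes c c' :: "'a :: euclidean_space"
  assumes "c \<noteq> c'" "0 < r" "0 < s" and ex1: "\<exists>!q. q \<in> sphere c r \<inter> sphere c' s"
  shows "dist c c' = r + s \<or> dist c c' = \<bar>r - s\<bar>"
proof -
  obtain q where q: "dist c q = r" "dist c' q = s" and uniq: "\<And>z. dist c z = r \<Longrightarrow> dist c' z = s \<Longrightarrow> z = q"
    using ex1 by auto
  define d where "d = c' - c"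
  define v where "v = q - c"
  define m where "m = (v \<bullet> d) / (d \<bullet> d)"
  define v' where "v' = (2 * m) *\<^sub>R d - v"
  have dd: "d \<bullet> d \<noteq> 0" using assms(1) by (simp add: d_def)
  then have md: "m * (d \<bullet> d) = v \<bullet> d" by (simp add: m_def)
  have vd: "v' \<bullet> d = v \<bullet> d"
    using md by (simp add: v'_def inner_diff_left)
  have "v' \<bullet> v' = v \<bullet> v + 4 * m * (m * (d \<bullet> d) - v \<bullet> d)"
    by (simp add: v'_def inner_diff_left inner_diff_right inner_commute algebra_simps)
  then have vv: "v' \<bullet> v' = v \<bullet> v" using md by simp
  have "norm v' = norm v" using vv by (simp add: norm_eq_sqrt_inner)
  moreover have "norm (d - v') = norm (d - v)"
    using vv vd by (simp add: norm_eq_sqrt_inner inner_diff_left inner_diff_right inner_commute)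
  ultimately have "dist c (c + v') = r" "dist c' (c + v') = s"
    using q by (auto simp: dist_norm d_def v_def norm_minus_commute algebra_simps)
  then have "c + v' = q" by (rule uniq)
  then have "v' = v" by (simp add: v_def algebra_simps)
  then have "2 *\<^sub>R v = 2 *\<^sub>R (m *\<^sub>R d)" unfolding v'_def by (simp add: scaleR_2 diff_eq_eq)
  then have "v = m *\<^sub>R d" by (metis scaleR_cancel_left zero_neq_numeral)
  moreover from this have "d - v = (1 - m) *\<^sub>R d" by (simp add: algebra_simps)
  ultimately have "norm v = \<bar>m\<bar> * norm d" "norm (d - v) = \<bar>1 - m\<bar> * norm d"
    by (simp_all only: norm_scaleR)
  moreover have "norm v = r" "norm (d - v) = s"
    using q by (auto simp: dist_norm d_def v_def norm_minus_commute)
  ultimately have rs: "r = \<bar>m\<bar> * norm d" "s = \<bar>1 - m\<bar> * norm d" by auto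
  have nd: "dist c c' = norm d" by (simp add: d_def dist_norm norm_minus_commute)
  consider "m < 0" | "0 \<le> m" "m \<le> 1" | "1 < m" by linarith
  then show ?thesis
    by cases (auto simp: rs nd algebra_simps abs_if)
qed

text \<open>A common point gives equality in the triangle inequality, so it lies on the segment
  between the centres and is fixed by its distances from them.\<close>

lemma external_tangent_unique:
  fixes c c' :: "'a :: euclidean_space"
  assumes d: "dist c c' = r + s" and "0 < r" "0 < s"
  shows "\<exists>!q. q \<in> sphere c r \<inter> sphere c' s"
proof
  define q where "q = c + (r / (r + s)) *\<^sub>R (c' - c)"
  have rs: "0 < r + s" using assms by simp
  have "c' - q = (1 - r / (r + s)) *\<^sub>R (c' - c)" by (simp add: q_def algebra_simps)
  moreover have "1 - r / (r + s) = s / (r + s)" using rs by (simp add: field_simps)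
  ultimately have "norm (c' - q) = s / (r + s) * norm (c' - c)" using assms by simp
  moreover have "norm (q - c) = r / (r + s) * norm (c' - c)" using assms by (simp add: q_def)
  moreover have "norm (c' - c) = r + s" using d by (simp add: dist_norm norm_minus_commute)
  ultimately show "q \<in> sphere c r \<inter> sphere c' s"
    using rs by (simp add: dist_norm norm_minus_commute)
  fix z assume z: "z \<in> sphere c r \<inter> sphere c' s"
  then have "dist c c' = dist c z + dist z c'" using d by (simp add: dist_commute)
  then have "norm (c - z) *\<^sub>R (z - c') = norm (z - c') *\<^sub>R (c - z)" by (simp only: dist_triangle_eq)
  then have "r *\<^sub>R (z - c') = s *\<^sub>R (c - z)" using z by (simp add: dist_norm norm_minus_commute)
  then have "(r + s) *\<^sub>R z = s *\<^sub>R c + r *\<^sub>R c'" by (simp add: algebra_simps)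
  moreover have "(r + s) *\<^sub>R q = (r + s) *\<^sub>R c + r *\<^sub>R (c' - c)"
    using rs by (simp add: q_def scaleR_add_right)
  ultimately have "(r + s) *\<^sub>R z = (r + s) *\<^sub>R q" by (simp add: algebra_simps)
  then show "z = q" using rs by simp
qed

lemma sphere_radius_unique:
  fixes c :: "'a :: euclidean_space"
  assumes "sphere c r = sphere c s" "0 < r"
  shows "r = s"
proof -
  have "sphere c r \<noteq> {}" using assms(2) by simp
  then obtain z where z: "z \<in> sphere c r" by blast
  then have "z \<in> sphere c s" using assms(1) by simp
  then show ?thesis using z by simp
qed

text \<open>The inclusion is tested at the point of the sphere around \<open>c'\<close> that is
  farthest from \<open>c\<close>.\<close>

lemma sphere_subset_cball_imp:
  fixes c c' :: "'a :: euclidean_space"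
  assumes sub: "sphere c' s \<subseteq> cball c r" and "c \<noteq> c'" "0 < s"
  shows "dist c c' + s \<le> r"
proof -
  let ?d = "norm (c' - c)"
  define w where "w = (s / ?d) *\<^sub>R (c' - c)"
  have d: "0 < ?d" using assms(2) by simp
  have "norm w = s" using d assms(3) by (simp add: w_def)
  then have "c' + w \<in> sphere c' s" by (simp add: dist_norm)
  then have "dist c (c' + w) \<le> r" using sub by auto
  moreover have "c' + w - c = (1 + s / ?d) *\<^sub>R (c' - c)" by (simp add: w_def algebra_simps)
  then have "norm (c' + w - c) = (1 + s / ?d) * ?d" using d assms(3) by simp
  then have "norm (c' + w - c) = ?d + s" using d by (simp add: field_simps)
  ultimately show ?thesis by (simp add: dist_norm norm_minus_commute)
qed

section \<open>Transfer to circles in the Euclidean plane\<close>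

definition plane :: "complex \<Rightarrow> real ^ 2" where
  "plane z = vector [Re z, Im z]"

lemma dist_plane [simp]: "dist (plane z) (plane w) = dist z w"
  by (simp add: dist_norm norm_vec_def L2_set_def sum_2 plane_def cmod_def)

lemma plane_eq_iff [simp]: "plane z = plane w \<longleftrightarrow> z = w"
  by (metis dist_eq_0_iff dist_plane)

theorem theorem9:
  fixes g k :: nat
  assumes "g \<ge> 3" and "k \<ge> 1"
  shows "\<exists>\<C> :: (real ^ 2) set set.
    (\<forall>A \<in> \<C>. is_circle A) \<and>
    (\<forall>A \<in> \<C>. \<forall>B \<in> \<C>. A \<noteq> B \<longrightarrow> \<not> concentric A B) \<and>
    (\<forall>A \<in> \<C>. \<forall>B \<in> \<C>. A \<noteq> B \<longrightarrow> \<not> internally_tangent A B) \<and>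
    girth (tangency_graph \<C>) \<ge> enat g \<and>
    chromatic_number (tangency_graph \<C>) \<ge> enat k"
proof -
  obtain V :: "nat set" and c R where S: "circle_system (Suc (Suc g)) k V c R"
    using circle_system_exists by blast
  have R: "0 < R v" if "v \<in> V" for v using S that by (simp add: circle_system_def)
  have c: "c v = c w \<longleftrightarrow> v = w" if "v \<in> V" "w \<in> V" for v w
    using S that by (auto simp: circle_system_def inj_on_def)
  have no_int: "dist (c v) (c w) \<noteq> \<bar>R v - R w\<bar>" if "v \<in> V" "w \<in> V" "v \<noteq> w" for v w
    using S that by (simp add: circle_system_def)
  have sp: "edge_sparse (Suc (Suc g)) (\<lambda>e. e) (touching V c R)" using S by (simp add: circle_system_def)
  have col: "\<exists>v w. {v, w} \<in> touching V c R \<and> \<kappa> v = \<kappa> w" if "\<forall>v. \<kappa> v < k" for \<kappa> :: "nat \<Rightarrow> nat"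
    using S that unfolding circle_system_def by blast
  define circ where "circ v = sphere (plane (c v)) (R v)" for v
  have is_circ: "is_circle (circ v)" if "v \<in> V" for v
    using R[OF that] unfolding is_circle_def circ_def by blast
  have centre: "z = plane (c v)" "r = R v" if "v \<in> V" "0 < r" "circ v = sphere z r" for v z r
  proof -
    show "z = plane (c v)"
      using sphere_centre_unique[of "plane (c v)" "R v" z r] that R[OF that(1)] by (simp add: circ_def)
    then show "r = R v"
      using sphere_radius_unique[of z r "R v"] that by (simp add: circ_def)
  qed
  have inj: "inj_on circ V"
    using centre(1)[OF _ R] c by (metis circ_def inj_onI plane_eq_iff)
  have touch: "{v, w} \<in> touching V c R" if vw: "v \<in> V" "w \<in> V" "v \<noteq> w" "tangent (circ v) (circ w)" for v w
  proof (rule touchingI)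
    have "\<exists>!q. q \<in> sphere (plane (c v)) (R v) \<inter> sphere (plane (c w)) (R w)"
      using vw(4) by (simp add: tangent_def circ_def)
    \<comment> \<open>The centres of tangent circles are at the sum or the difference of the radii,
      and \<open>no_int\<close> excludes the difference.\<close>
    then show "dist (c v) (c w) = R v + R w"
      using tangent_spheres_dist[of "plane (c v)" "plane (c w)" "R v" "R w"] vw R c no_int by auto
  qed (use vw in auto)
  have touch_dist: "v \<in> V \<and> w \<in> V \<and> dist (c v) (c w) = R v + R w" if "{v, w} \<in> touching V c R" for v w
    using that by (auto simp: touching_def doubleton_eq_iff dist_commute add.commute)
  have tang: "tangent (circ v) (circ w)" if "{v, w} \<in> touching V c R" for v w
    using touch_dist[OF that] is_circ R external_tangent_unique[of "plane (c v)" "plane (c w)" "R v" "R w"]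
    by (simp add: tangent_def circ_def)
  let ?C = "circ ` V"
  have "\<not> concentric (circ v) (circ w)" if vw: "v \<in> V" "w \<in> V" "circ v \<noteq> circ w" for v w
  proof
    assume "concentric (circ v) (circ w)"
    then have "plane (c v) = plane (c w)" unfolding concentric_def using centre(1) vw by metis
    then show False using c vw by auto
  qed
  moreover have "\<not> internally_tangent (circ v) (circ w)" if vw: "v \<in> V" "w \<in> V" "circ v \<noteq> circ w" for v w
  proof
    assume it: "internally_tangent (circ v) (circ w)"
    have ne: "v \<noteq> w" using vw by blast
    have d: "dist (c v) (c w) = R v + R w"
      using touch_dist touch[OF vw(1,2) ne] it by (simp add: internally_tangent_def)
    \<comment> \<open>Enclosure bounds the distance of the centres by the difference of the radii,
      which contradicts external contact.\<close>
    have enc: "dist (c a) (c b) + R b \<le> R a" if ab: "a \<in> V" "b \<in> V" "a \<noteq> b" "encloses (circ a) (circ b)" for a b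
    proof -
      obtain z r where "0 < r" "circ a = sphere z r" "circ b \<subseteq> cball z r"
        using ab(4) unfolding encloses_def by blast
      then have "circ b \<subseteq> cball (plane (c a)) (R a)" using centre[OF ab(1)] by metis
      then show ?thesis
        using sphere_subset_cball_imp[of "plane (c b)" "R b" "plane (c a)" "R a"] ab R c by (simp add: circ_def)
    qed
    have "encloses (circ v) (circ w) \<or> encloses (circ w) (circ v)"
      using it by (simp add: internally_tangent_def)
    then show False
      using enc[OF vw(1,2) ne] enc[OF vw(2,1)] ne d R[OF vw(1)] R[OF vw(2)] by (auto simp: dist_commute)
  qed
  moreover have "enat g \<le> girth (tangency_graph ?C)"
    unfolding girth_def
  proof (rule Inf_greatest)
    fix x assume "x \<in> {enat (length p) |p. is_cycle (tangency_graph ?C) p}"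
    then obtain p where x: "x = enat (length p)" and p: "is_cycle (tangency_graph ?C) p" by blast
    have len: "3 \<le> length p" and dist: "distinct p" and sub: "set p \<subseteq> ?C"
      and edge: "\<And>i. i < length p \<Longrightarrow> {p ! i, p ! (Suc i mod length p)} \<in> snd (tangency_graph ?C)"
      using p by (auto simp: is_cycle_def tangency_graph_def)
    \<comment> \<open>The cycle is pulled back to labels, where edge sparsity bounds its length from
      below.\<close>
    define q where "q = map (inv_into V circ) p"
    have lq: "length q = length p" by (simp add: q_def)
    have qV: "q ! i \<in> V" "circ (q ! i) = p ! i" if "i < length p" for i
      using that sub nth_mem[OF that] by (auto simp: q_def inv_into_into f_inv_into_f subset_iff)
    have "distinct q"
      using dist sub by (auto simp: q_def distinct_map intro: inj_on_inv_into)
    moreover have "{q ! i, q ! (Suc i mod length q)} \<in> touching V c R" if "i < length q" for i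
    proof -
      define j where "j = Suc i mod length p"
      have i: "i < length p" "j < length p" "i \<noteq> j"
        using that lq len by (auto simp: j_def mod_Suc)
      have "{p ! i, p ! j} \<in> snd (tangency_graph ?C)" using edge[OF i(1)] by (simp add: j_def)
      then have "tangent (p ! i) (p ! j)"
        by (auto simp: tangency_graph_def doubleton_eq_iff tangent_def Int_commute)
      moreover have "q ! i \<noteq> q ! j" using i dist qV by (metis nth_eq_iff_index_eq)
      ultimately have "{q ! i, q ! j} \<in> touching V c R" using touch qV i by simp
      then show ?thesis by (simp add: j_def lq)
    qed
    ultimately have "Suc (Suc g) < length q"
      using sparse_imp_long_cycle[OF sp, of q] len lq by simp
    then show "enat g \<le> x" by (simp add: x lq)
  qed
  moreover have "enat k \<le> chromatic_number (tangency_graph ?C)"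
    unfolding chromatic_number_def
  proof (rule Inf_greatest)
    fix x assume "x \<in> {enat n |n. \<exists>f. proper_colouring (tangency_graph ?C) n f}"
    then obtain n f where x: "x = enat n" and f: "proper_colouring (tangency_graph ?C) n f" by blast
    show "enat k \<le> x"
    proof (rule ccontr)
      assume "\<not> enat k \<le> x"
      then have n: "n < k" by (simp add: x)
      \<comment> \<open>Outside \<open>V\<close> the value is 0, which is below \<open>k\<close>
        because \<open>k \<ge> 1\<close>.\<close>
      let ?\<kappa> = "\<lambda>v. if v \<in> V then f (circ v) else 0"
      have fn: "f (circ v) < n" if "v \<in> V" for v
        using f that by (auto simp: proper_colouring_def tangency_graph_def)
      then have "\<forall>v. ?\<kappa> v < k" using n assms(2) by (auto intro: less_trans)
      then obtain v w where vw: "{v, w} \<in> touching V c R" "?\<kappa> v = ?\<kappa> w" using col[of ?\<kappa>] by blast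
      then have V: "v \<in> V" "w \<in> V" using touch_dist by blast+
      have "{circ v, circ w} \<in> snd (tangency_graph ?C)"
        using tang[OF vw(1)] V unfolding tangency_graph_def by auto
      then have "f (circ v) \<noteq> f (circ w)"
        using f V by (simp add: proper_colouring_def tangency_graph_def)
      then show False using vw(2) V by simp
    qed
  qed
  ultimately show ?thesis using is_circ by (intro exI[of _ ?C]) auto
qed

end
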